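(* Let $\mathcal{T}$ be a regular tetrahedron in $\mathbb{R}^3$ with centroid at the origin whose vertices $A,B,C,D$ lie on the unit sphere $\mathbb{S}^2$. Let $\boldsymbol{\alpha}=(\alpha_1,\alpha_2)\in\mathbb{R}^2$ be a badly approximable vector with $\alpha_1,\alpha_2>0$. Let $\mathfrak{t}_{\boldsymbol{\alpha}}:[0,\infty)\to\partial\mathcal{T}$ be the linear (geodesic) flow on the surface of $\mathcal{T}$ starting at the vertex $B$ on the face $ABC$ in direction $\boldsymbol{\alpha}$: that is, $\mathfrak{t}_{\boldsymbol{\alpha}}(t)=B+t\alpha_1\overrightarrow{BC}+t\alpha_2\overrightarrow{BA}$ as long as this point remains on the face $ABC$, and whenever the path hits an edge it is continued straight into the adjacent face by unfolding (rotating the two faces sharing that edge into a common plane, extending the line, and folding back), this process being repeated. Let $\mathfrak{r}:\mathbb{R}^3\setminus\{\boldsymbol{0}\}\to\mathbb{S}^2$, $\mathfrak{r}(\boldsymbol{x})=\boldsymbol{x}/\|\boldsymbol{x}\|_2$. Let $\gamma>0$. Define $j_1=1$, $\boldsymbol{u}_1=(\mathfrak{r}\circ\mathfrak{t}_{\boldsymbol{\alpha}})(j_1)$, and for $k\ge2$, inductively, $$\mathfrak{D}_k=\bigcup_{1\le m<k^{2/3}}\mathcal{C}_2\!\left(\boldsymbol{u}_{k-m},\frac{\gamma}{k^{1/3}}\right),\quad j_k=\min\{p\in\mathbb{N}:p>j_{k-1},\ (\mathfrak{r}\circ\mathfrak{t}_{\boldsymbol{\alpha}})(p)\notin\mathfrak{D}_k\},\quad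 \boldsymbol{u}_k=(\mathfrak{r}\circ\mathfrak{t}_{\boldsymbol{\alpha}})(j_k).$$ Then, for $\gamma>0$ small enough, the integer sequence $(j_k)_{k\ge1}$ is well-defined (i.e., each minimum exists), and the spiral set $\{\sqrt[3]{k}\,\boldsymbol{u}_k\}_{k\ge1}$ is a Delone set in $\mathbb{R}^3$.
   Context: A vector $\boldsymbol{\alpha}\in\mathbb{R}^2$ is badly approximable if $\inf_{q\ge1}q^{1/2}\min_{\boldsymbol{m}\in\mathbb{Z}^2}\|q\boldsymbol{\alpha}-\boldsymbol{m}\|_\infty>0$; in particular $\alpha_1/\alpha_2$ is irrational, so the flow never hits a vertex and is well defined. For $\boldsymbol{w}\in\mathbb{S}^2$ and $\rho>0$, $\mathcal{C}_2(\boldsymbol{w},\rho)=\{\boldsymbol{u}\in\mathbb{S}^2:\arccos(\boldsymbol{u}\cdot\boldsymbol{w})\le\rho\}$ is the spherical cap of geodesic radius $\rho$. A set $\mathfrak{B}\subset\mathbb{R}^3$ is Delone if it is uniformly discrete ($\inf\{\|\boldsymbol{x}-\boldsymbol{y}\|_2:\boldsymbol{x}\ne\boldsymbol{y}\in\mathfrak{B}\}>0$) and relatively dense ($\sup_{\boldsymbol{x}\in\mathbb{R}^3}\inf_{\boldsymbol{y}\in\mathfrak{B}}\|\boldsymbol{x}-\boldsymbol{y}\|_2<\infty$). *)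

theory Defs
  imports "HOL-Analysis.Analysis"
begin

definition regular_tetrahedron :: "real^3 \<Rightarrow> real^3 \<Rightarrow> real^3 \<Rightarrow> real^3 \<Rightarrow> bool" where
  "regular_tetrahedron A B C D \<longleftrightarrow>
     (\<exists>l>0. dist A B = l \<and> dist A C = l \<and> dist A D = l \<and>
            dist B C = l \<and> dist B D = l \<and> dist C D = l)"

definition badly_approximable :: "real^2 \<Rightarrow> bool" where
  "badly_approximable \<alpha> \<longleftrightarrow>
     0 < (INF q\<in>{1::nat..}. sqrt (real q) *
            (INF m\<in>{m::real^2. \<forall>i. m $ i \<in> \<int>}. infnorm (real q *\<^sub>R \<alpha> - m)))"

definition delone :: "'a::metric_space set \<Rightarrow> bool" where
  (* infdist x {} = 0 by convention, so relative density must exclude the empty set *)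
  "delone S \<longleftrightarrow> uniform_discrete S \<and> S \<noteq> {} \<and> bdd_above (range (\<lambda>x. infdist x S))"

definition radial :: "real^3 \<Rightarrow> real^3" where
  "radial x = x /\<^sub>R norm x"

definition spherical_cap :: "real^3 \<Rightarrow> real \<Rightarrow> (real^3) set" where
  "spherical_cap w \<rho> = {u \<in> sphere 0 1. arccos (u \<bullet> w) \<le> \<rho>}"

text \<open>
  The linear flow is a sequence of straight legs, each inside one face. A face of the
  tetrahedron with vertex set \<open>V\<close> is given by the vertex \<open>w\<close> it omits, so that it is
  \<open>convex hull (V - {w})\<close>; the edge shared by the faces omitting \<open>w\<close> and \<open>z\<close> is
  \<open>convex hull (V - {w, z})\<close>.
\<close>

record leg =
  omitted :: "real^3"
  start_time :: real
  start_point :: "real^3"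
  velocity :: "real^3"

definition leg_duration :: "(real^3) set \<Rightarrow> leg \<Rightarrow> real" where
  "leg_duration V l =
     Sup {\<tau>. 0 \<le> \<tau> \<and> start_point l + \<tau> *\<^sub>R velocity l \<in> convex hull (V - {omitted l})}"

definition end_time :: "(real^3) set \<Rightarrow> leg \<Rightarrow> real" where
  "end_time V l = start_time l + leg_duration V l"

definition end_point :: "(real^3) set \<Rightarrow> leg \<Rightarrow> real^3" where
  "end_point V l = start_point l + leg_duration V l *\<^sub>R velocity l"

text \<open>
  Unfolding across the edge between the faces omitting \<open>w\<close> (the current one, containing \<open>z\<close>)
  and \<open>z\<close> (the next one, containing \<open>w\<close>). Let \<open>n\<close> be the unit normal of the edge in the plane
  of the current face, pointing out of that face, and \<open>n'\<close> the unit normal of the edge in the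
  plane of the next face, pointing into that face. The rotation about the edge that folds the
  continuation of the current plane onto the next face fixes the edge direction and maps \<open>n\<close>
  to \<open>n'\<close>; on a direction \<open>v\<close> parallel to the current face it is \<open>v - (v \<bullet> n) n + (v \<bullet> n) n'\<close>.
\<close>

definition fold_direction :: "(real^3) set \<Rightarrow> real^3 \<Rightarrow> real^3 \<Rightarrow> real^3 \<Rightarrow> real^3" where
  "fold_direction V w z v =
     (let L = affine hull (V - {w, z});
          n = sgn (closest_point L z - z);
          n' = sgn (w - closest_point L w)
      in v - (v \<bullet> n) *\<^sub>R n + (v \<bullet> n) *\<^sub>R n')"

text \<open>
  The edge that is hit is determined by the vertex \<open>z\<close> opposite to it in the current face.
  It is unique unless the flow hits a vertex.
\<close>

definition next_leg :: "(real^3) set \<Rightarrow> leg \<Rightarrow> leg" where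
  "next_leg V l =
     (let w = omitted l;
          z = (THE z. z \<in> V - {w} \<and> end_point V l \<in> convex hull (V - {w, z}))
      in \<lparr> omitted = z,
           start_time = end_time V l,
           start_point = end_point V l,
           velocity = fold_direction V w z (velocity l) \<rparr>)"

definition flow_leg ::
  "real^3 \<Rightarrow> real^3 \<Rightarrow> real^3 \<Rightarrow> real^3 \<Rightarrow> real^2 \<Rightarrow> nat \<Rightarrow> leg" where
  "flow_leg A B C D \<alpha> n =
     (next_leg {A, B, C, D} ^^ n)
       \<lparr> omitted = D,
         start_time = 0,
         start_point = B,
         velocity = (\<alpha> $ 1) *\<^sub>R (C - B) + (\<alpha> $ 2) *\<^sub>R (A - B) \<rparr>"

definition tetra_flow ::
  "real^3 \<Rightarrow> real^3 \<Rightarrow> real^3 \<Rightarrow> real^3 \<Rightarrow> real^2 \<Rightarrow> real \<Rightarrow> real^3" where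
  "tetra_flow A B C D \<alpha> t =
     (let n = (LEAST n. t \<le> end_time {A, B, C, D} (flow_leg A B C D \<alpha> n));
          l = flow_leg A B C D \<alpha> n
      in start_point l + (t - start_time l) *\<^sub>R velocity l)"

definition excluded_region :: "real \<Rightarrow> nat \<Rightarrow> (nat \<Rightarrow> real^3) \<Rightarrow> (real^3) set" where
  "excluded_region \<gamma> k u =
     (\<Union>m\<in>{m. 1 \<le> m \<and> real m < real k powr (2/3)}.
        spherical_cap (u (k - m)) (\<gamma> / real k powr (1/3)))"

lemma excluded_region_cong [fundef_cong]:
  assumes "\<gamma> = \<gamma>'" and "k = k'" and "\<And>i. 1 \<le> i \<Longrightarrow> i < k' \<Longrightarrow> u i = u' i"
  shows "excluded_region \<gamma> k u = excluded_region \<gamma>' k' u'"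
proof -
  have "u (k - m) = u' (k - m)" if "1 \<le> m" "real m < real k powr (2/3)" for m
  proof -
    have "k \<noteq> 0"
      using that by (intro notI) simp
    then have "real k powr (2/3) \<le> real k powr 1"
      by (intro powr_mono) auto
    then have "m < k"
      using that \<open>k \<noteq> 0\<close> by simp
    then show ?thesis
      using that assms(2) by (intro assms(3)) auto
  qed
  then show ?thesis
    unfolding excluded_region_def assms(1,2)[symmetric] by auto
qed

text \<open>
  \<open>greedy_index x \<gamma> k\<close> is \<open>j\<^sub>k\<close> for the sequence of candidate points \<open>x\<close>; indices start at 1,
  and the value at 0 plays no role.
\<close>

function greedy_index :: "(nat \<Rightarrow> real^3) \<Rightarrow> real \<Rightarrow> nat \<Rightarrow> nat" where
  "greedy_index x \<gamma> k =
     (if k \<le> 1 then 1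
      else (LEAST p. p > greedy_index x \<gamma> (k - 1) \<and>
                     x p \<notin> excluded_region \<gamma> k (\<lambda>i. x (greedy_index x \<gamma> i))))"
  by pat_completeness auto
termination
  by (relation "Wellfounded.measure (\<lambda>(x, \<gamma>, k). k)") auto

declare greedy_index.simps [simp del]

end

theory Submission
  imports Defs
begin

text \<open>
  Unfolded onto the plane, the flow is the ray \<open>t \<alpha>\<close>, and the surface is the image of the plane under
  a Lipschitz map that is affine on each lattice triangle and periodic with respect to twice the
  lattice. In the orthogonal frame of the midpoints of the edges at \<open>B\<close> its three coordinates are a triangle wave
  evaluated at \<open>x\<close>, \<open>y\<close> and \<open>x + y\<close>. For badly approximable \<open>\<alpha>\<close> every run of \<open>N\<close> consecutive
  multiples of \<open>\<alpha>\<close> is dense up to \<open>O(1 / sqrt N)\<close> modulo \<open>2\<int>\<^sup>2\<close>: a unimodular lattice in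
  \<open>\<real>\<^sup>3\<close> without short vectors has three linearly independent vectors of bounded length.
  Hence the candidate points have the same density on the sphere. This alone implies the claim:
  separation is built into the greedy choice, except for indices that differ by at least
  \<open>k powr (2/3)\<close>, and the corresponding radii then differ by at least a constant.
\<close>

subsection \<open>Multiples of a badly approximable vector\<close>

text \<open>The exponents make the construction scale free: \<open>k powr (2/3)\<close> consecutive
  indices fill a shell of bounded thickness at radius \<open>root 3 k\<close>, and that many caps of
  radius \<open>\<gamma> / root 3 k\<close> cover an area of order \<open>\<gamma>\<^sup>2\<close>
  on the sphere, whatever \<open>k\<close> is. A small \<gamma> thus leaves room for the next point.
  The greedy choice may skip many candidates, so \<open>j k\<close> is not controlled from above.
  The density argument counts along the candidates instead: the index \<open>j\<close> grows by at
  least 1 per selection, so any run of \<open>l\<close> candidates is passed after at most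
  \<open>l\<close> further selections. On the geometric side the flow is defined through suprema,
  least numbers and unique choices. Its explicit formula is obtained leg by leg, and each leg needs
  an exit point in the interior of an edge. The periods of the folding form
  \<open>2\<int>\<^sup>2\<close>, so the Diophantine part is applied to
  \<open>\<alpha> / 2\<close>.\<close>

lemma lattice_covering_radius:
  fixes L :: "(real^'n) set" and R :: real
  assumes zero: "0 \<in> L" and add: "\<And>x y. x \<in> L \<Longrightarrow> y \<in> L \<Longrightarrow> x + y \<in> L"
    and scale: "\<And>x (k::int). x \<in> L \<Longrightarrow> of_int k *\<^sub>R x \<in> L"
    and spanning: "\<And>n. (\<And>v. v \<in> L \<Longrightarrow> (\<And>i. \<bar>v $ i\<bar> \<le> R) \<Longrightarrow> n \<bullet> v = 0) \<Longrightarrow> n = 0"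
  shows "\<exists>v\<in>L. \<forall>i. \<bar>x $ i - v $ i\<bar> \<le> CARD('n) * R / 2"
proof -
  define S where "S = {v \<in> L. \<forall>i. \<bar>v $ i\<bar> \<le> R}"
  have dim: "dim S = CARD('n)"
  proof (rule ccontr)
    assume "dim S \<noteq> CARD('n)"
    then have "dim S < DIM(real^'n)"
      using dim_subset_UNIV[of S] by simp
    then obtain n where n: "n \<noteq> 0" "span S \<subseteq> {x. n \<bullet> x = 0}"
      using lowdim_subset_hyperplane by blast
    have "n = 0"
    proof (rule spanning)
      fix v assume "v \<in> L" "\<And>i. \<bar>v $ i\<bar> \<le> R"
      then have "v \<in> span S" by (intro span_base) (simp add: S_def)
      then show "n \<bullet> v = 0" using n(2) by blast
    qed
    then show False using n by simp
  qed
  obtain T where T: "T \<subseteq> S" "independent T" "S \<subseteq> span T" "card T = dim S"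
    by (rule basis_exists)
  have fin: "finite T" using T(2) by (rule independent_imp_finite)
  have "UNIV \<subseteq> span T"
    using T dim by (intro card_ge_dim_independent) auto
  then have "x \<in> span T" by blast
  then obtain u where u: "x = (\<Sum>b\<in>T. u b *\<^sub>R b)"
    using span_finite[OF fin] by auto
  \<comment> \<open>Rounding the coordinates of \<open>x\<close> in a basis of short vectors: each
    basis vector contributes an error of at most \<open>R / 2\<close> to every component.\<close>
  define v where "v = (\<Sum>b\<in>T. of_int (round (u b)) *\<^sub>R b)"
  have TL: "b \<in> L" "\<bar>b $ i\<bar> \<le> R" if "b \<in> T" for b i
    using that T(1) by (auto simp: S_def)
  have "v \<in> L"
    unfolding v_def using fin TL(1)
    by (induction T rule: finite_induct) (auto simp: zero intro!: add scale)
  moreover have "\<bar>x $ i - v $ i\<bar> \<le> CARD('n) * R / 2" for i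
  proof -
    have "x $ i - v $ i = (\<Sum>b\<in>T. (u b - of_int (round (u b))) * b $ i)"
      by (simp add: u v_def sum_subtractf algebra_simps)
    also have "\<bar>\<dots>\<bar> \<le> (\<Sum>b\<in>T. \<bar>(u b - of_int (round (u b))) * b $ i\<bar>)"
      by (rule sum_abs)
    also have "\<dots> \<le> (\<Sum>b\<in>T. 1/2 * R)"
    proof (intro sum_mono)
      fix b assume b: "b \<in> T"
      have "\<bar>u b - of_int (round (u b))\<bar> \<le> 1/2"
        using of_int_round_abs_le[of "u b"] by (simp add: abs_minus_commute)
      then show "\<bar>(u b - of_int (round (u b))) * b $ i\<bar> \<le> 1/2 * R"
        unfolding abs_mult using TL(2)[OF b] by (intro mult_mono) auto
    qed
    also have "\<dots> = CARD('n) * R / 2" using T(4) dim by simp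
    finally show ?thesis .
  qed
  ultimately show ?thesis by blast
qed

text \<open>The lattice of the Dani correspondence: a unipotent image of \<int>^3 (up to signs),
  stretched by diag(1/s^2, s, s) of determinant 1. Bad approximability keeps its vectors with
  \<open>q \<noteq> 0\<close> away from 0 uniformly in \<open>s\<close>.\<close>

definition approx_vec :: "real \<Rightarrow> real \<Rightarrow> real \<Rightarrow> int \<Rightarrow> int \<Rightarrow> int \<Rightarrow> real^3" where
  "approx_vec \<beta>\<^sub>1 \<beta>\<^sub>2 s q m\<^sub>1 m\<^sub>2 = vector [q / s\<^sup>2, s * (q * \<beta>\<^sub>1 - m\<^sub>1), s * (q * \<beta>\<^sub>2 - m\<^sub>2)]"

lemma approx_vec_nth [simp]:
  "approx_vec \<beta>\<^sub>1 \<beta>\<^sub>2 s q m\<^sub>1 m\<^sub>2 $ 1 = q / s\<^sup>2"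
  "approx_vec \<beta>\<^sub>1 \<beta>\<^sub>2 s q m\<^sub>1 m\<^sub>2 $ 2 = s * (q * \<beta>\<^sub>1 - m\<^sub>1)"
  "approx_vec \<beta>\<^sub>1 \<beta>\<^sub>2 s q m\<^sub>1 m\<^sub>2 $ 3 = s * (q * \<beta>\<^sub>2 - m\<^sub>2)"
  by (simp_all add: approx_vec_def)

text \<open>The sum of the two errors matches the 1-norm in which lattice vectors are measured
  below. The pair is kept abstract because it will be instantiated with
  \<open>\<alpha> / 2\<close>.\<close>

locale bad_pair =
  fixes \<beta>\<^sub>1 \<beta>\<^sub>2 c :: real
  assumes c_pos: "c > 0"
    and bad: "\<And>(q::nat) (m\<^sub>1::int) (m\<^sub>2::int). (1::nat) \<le> q \<Longrightarrow> c \<le> sqrt q * (\<bar>q * \<beta>\<^sub>1 - m\<^sub>1\<bar> + \<bar>q * \<beta>\<^sub>2 - m\<^sub>2\<bar>)"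
begin

text \<open>For \<open>\<bar>q\<bar> \<ge> s\<^sup>2\<close> the first coordinate alone is at least
  1. Otherwise \<open>sqrt \<bar>q\<bar> \<le> s\<close>, and \<open>bad\<close> bounds the other
  two coordinates from below by \<open>c\<close>.\<close>

lemma approx_vec_long:
  assumes "q \<noteq> 0" "s > 0"
  shows "min 1 c \<le> (\<Sum>i\<in>UNIV. \<bar>approx_vec \<beta>\<^sub>1 \<beta>\<^sub>2 s q m\<^sub>1 m\<^sub>2 $ i\<bar>)"
proof (cases "\<bar>real_of_int q\<bar> \<ge> s\<^sup>2")
  case True
  then have "1 \<le> \<bar>q / s\<^sup>2\<bar>" using assms by (simp add: abs_divide)
  then show ?thesis by (simp add: sum_3)
next
  case False
  define n where "n = nat \<bar>q\<bar>"
  \<comment> \<open>\<open>bad\<close> concerns positive multiples, so the sign of \<open>q\<close>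
    is moved into \<open>m\<^sub>1\<close> and \<open>m\<^sub>2\<close>.\<close>
  define e where "e = sgn q"
  have n: "1 \<le> n" "real n = \<bar>real_of_int q\<bar>" using assms by (auto simp: n_def)
  have e: "\<bar>real_of_int e\<bar> = 1" "real_of_int e * q = real n"
    using assms unfolding n(2) e_def by (auto simp: sgn_if)
  have abs_e: "\<bar>n * \<beta> - of_int (e * m)\<bar> = \<bar>q * \<beta> - m\<bar>" for \<beta> :: real and m :: int
  proof -
    have "n * \<beta> - of_int (e * m) = e * (q * \<beta> - m)" using e by (simp add: algebra_simps)
    then show ?thesis using e by (simp add: abs_mult)
  qed
  have "sqrt n \<le> s" using False n(2) assms by (intro real_le_lsqrt) auto
  then have "sqrt n * (\<bar>q * \<beta>\<^sub>1 - m\<^sub>1\<bar> + \<bar>q * \<beta>\<^sub>2 - m\<^sub>2\<bar>) \<le> s * (\<bar>q * \<beta>\<^sub>1 - m\<^sub>1\<bar> + \<bar>q * \<beta>\<^sub>2 - m\<^sub>2\<bar>)"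
    by (intro mult_right_mono) auto
  then have "c \<le> s * (\<bar>q * \<beta>\<^sub>1 - m\<^sub>1\<bar> + \<bar>q * \<beta>\<^sub>2 - m\<^sub>2\<bar>)"
    using bad[OF n(1), of "e * m\<^sub>1" "e * m\<^sub>2"] unfolding abs_e by linarith
  then show ?thesis using assms by (simp add: sum_3 abs_mult distrib_left min_le_iff_disj add_increasing add.assoc)
qed

text \<open>If all short vectors of the lattice lie in a plane, two coordinates of them control the third.
  A pigeonhole argument then needs a fine partition in two directions only; it finds two points whose
  difference is both short, hence in that plane, and shorter than \<open>approx_vec_long\<close> permits.\<close>

lemma short_vectors_spanning:
  fixes K a :: nat and n :: "real^3" and R :: real
  defines "R \<equiv> real (K\<^sup>2 + 1)"
  assumes K: "4 < K * min 1 c" and a: "a \<ge> 1"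
    and perp: "\<And>q m\<^sub>1 m\<^sub>2. (\<And>i. \<bar>approx_vec \<beta>\<^sub>1 \<beta>\<^sub>2 (R * a) q m\<^sub>1 m\<^sub>2 $ i\<bar> \<le> R) \<Longrightarrow>
      n \<bullet> approx_vec \<beta>\<^sub>1 \<beta>\<^sub>2 (R * a) q m\<^sub>1 m\<^sub>2 = 0"
  shows "n = 0"
proof (rule ccontr)
  assume "n \<noteq> 0"
  have K0: "K > 0" using K by (cases K) auto
  define R' where "R' = K\<^sup>2 + 1"
  have R: "R = real R'" "R' > 0" by (simp_all add: R_def R'_def)
  have "\<exists>i. \<forall>j. \<bar>n $ j\<bar> \<le> \<bar>n $ i\<bar>"
  proof -
    let ?N = "range (\<lambda>j. \<bar>n $ j\<bar>)"
    have "Max ?N \<in> ?N" by (rule Max_in) auto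
    then obtain i where "Max ?N = \<bar>n $ i\<bar>" by blast
    moreover have "\<bar>n $ j\<bar> \<le> Max ?N" for j by (rule Max_ge) auto
    ultimately show ?thesis by auto
  qed
  then obtain i where i: "\<And>j. \<bar>n $ j\<bar> \<le> \<bar>n $ i\<bar>" by blast
  have ni: "\<bar>n $ i\<bar> > 0"
  proof (rule ccontr)
    assume "\<not> ?thesis"
    then have "n $ j = 0" for j using i[of j] by simp
    then show False using \<open>n \<noteq> 0\<close> by (simp add: vec_eq_iff)
  qed
  have dominated: "\<bar>v $ i\<bar> \<le> (\<Sum>j\<in>UNIV - {i}. \<bar>v $ j\<bar>)" if "n \<bullet> v = 0" for v
  proof -
    have "0 = n $ i * v $ i + (\<Sum>j\<in>UNIV - {i}. n $ j * v $ j)"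
      using that by (simp add: inner_vec_def sum.remove[of UNIV i])
    then have "\<bar>n $ i\<bar> * \<bar>v $ i\<bar> = \<bar>\<Sum>j\<in>UNIV - {i}. n $ j * v $ j\<bar>"
      by (metis abs_minus_cancel abs_mult add.commute add_eq_0_iff)
    also have "\<dots> \<le> (\<Sum>j\<in>UNIV - {i}. \<bar>n $ i\<bar> * \<bar>v $ j\<bar>)"
      by (rule order_trans[OF sum_abs], intro sum_mono) (auto simp: abs_mult intro: mult_right_mono i)
    finally show ?thesis using ni by (simp flip: sum_distrib_left)
  qed
  \<comment> \<open>This is \<open>R * (R * a)\<^sup>2\<close>, so for \<open>q < Q\<close> the
    first lattice coordinate runs through \<open>[0, R)\<close>.\<close>
  define Q where "Q = R' ^ 3 * a\<^sup>2"
  define X :: "nat \<Rightarrow> real^3" where "X = (\<lambda>q. vector [q / Q, frac (q * \<beta>\<^sub>1), frac (q * \<beta>\<^sub>2)])"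
  define e :: "3 \<Rightarrow> nat" where "e = (\<lambda>j. if j = 1 then 1 else a)"
  \<comment> \<open>Numbers of boxes per direction. Measured on the lattice vector, a box has side
    \<open>R\<close> along \<open>i\<close> and side \<open>1 / K\<close> along the two other
    directions.\<close>
  define d where "d = (\<lambda>j. if j = i then e j else e j * (R' * K))"
  define f where "f = (\<lambda>q j. nat \<lfloor>d j * X q $ j\<rfloor>)"
  have Q0: "Q > 0" using R a by (simp add: Q_def)
  have d0: "d j > 0" for j using a K0 R by (simp add: d_def e_def)
  have X: "0 \<le> X q $ j" "X q $ j < 1" if "q < Q" for q j
    using that Q0 exhaust_3[of j] by (auto simp: X_def frac_lt_1)
  have "f ` {..<Q} \<subseteq> PiE UNIV (\<lambda>j. {..<d j})"
  proof (safe intro!: PiE_I)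
    fix q j assume "q < Q"
    then have "real (d j) * X q $ j < real (d j) * 1"
      using X d0[of j] by (intro mult_strict_left_mono) auto
    then show "f q j < d j" using X[OF \<open>q < Q\<close>, of j] by (simp add: f_def nat_less_iff floor_less_iff)
  qed simp
  then have "card (f ` {..<Q}) \<le> card (PiE (UNIV :: 3 set) (\<lambda>j. {..<d j}))"
    by (intro card_mono) (auto intro: finite_PiE)
  also have "\<dots> = (\<Prod>j\<in>UNIV. d j)" by (simp add: card_PiE)
  also have "\<dots> = a\<^sup>2 * (R' * K)\<^sup>2"
    using exhaust_3[of i] unfolding UNIV_3 by (auto simp: d_def e_def power2_eq_square)
  \<comment> \<open>After cancellation this is \<open>K\<^sup>2 < R'\<close>, the reason for the
    choice \<open>R' = K\<^sup>2 + 1\<close>.\<close>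
  also have "\<dots> < Q"
  proof -
    have "(R' * K)\<^sup>2 < R' ^ 3"
      using R by (simp add: power_mult_distrib power3_eq_cube power2_eq_square) (simp add: R'_def power2_eq_square)
    then show ?thesis using a by (simp add: Q_def)
  qed
  finally have "\<not> inj_on f {..<Q}" by (intro pigeonhole) simp
  then obtain q q' where q: "q < Q" "q' < Q" "f q = f q'" "q \<noteq> q'"
    unfolding inj_on_def by auto
  define v where "v = approx_vec \<beta>\<^sub>1 \<beta>\<^sub>2 (R * a) (int q - int q') (\<lfloor>q * \<beta>\<^sub>1\<rfloor> - \<lfloor>q' * \<beta>\<^sub>1\<rfloor>) (\<lfloor>q * \<beta>\<^sub>2\<rfloor> - \<lfloor>q' * \<beta>\<^sub>2\<rfloor>)"
  have v: "v $ j = R * e j * (X q $ j - X q' $ j)" for j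
  proof -
    have "R * (q / Q - q' / Q) = (real q - real q') / (R * a)\<^sup>2"
      using R(2) a unfolding diff_divide_distrib[symmetric] Q_def R(1)
      by (simp add: power2_eq_square power3_eq_cube)
    then show ?thesis
      using exhaust_3[of j] by (auto simp: v_def X_def e_def frac_def algebra_simps)
  qed
  have v_less: "\<bar>v $ j\<bar> < R * e j / d j" for j
  proof -
    have "\<lfloor>d j * X q $ j\<rfloor> = \<lfloor>d j * X q' $ j\<rfloor>"
    proof -
      have "0 \<le> \<lfloor>d j * X q $ j\<rfloor>" "0 \<le> \<lfloor>d j * X q' $ j\<rfloor>" using X q by simp_all
      moreover have "nat \<lfloor>d j * X q $ j\<rfloor> = nat \<lfloor>d j * X q' $ j\<rfloor>"
        using fun_cong[OF q(3), of j] by (simp add: f_def)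
      ultimately show ?thesis using eq_nat_nat_iff by blast
    qed
    then have "\<bar>d j * X q $ j - d j * X q' $ j\<bar> < 1" by linarith
    then have "d j * \<bar>X q $ j - X q' $ j\<bar> < 1"
      by (simp add: abs_mult flip: right_diff_distrib)
    then have "\<bar>X q $ j - X q' $ j\<bar> < 1 / d j" using d0[of j] by (simp add: field_simps)
    moreover have "R * e j > 0" using R a by (simp add: e_def)
    ultimately show ?thesis unfolding v abs_mult
      using mult_strict_left_mono[of "\<bar>X q $ j - X q' $ j\<bar>" "1 / d j" "R * e j"] by (simp add: R(1))
  qed
  have vi: "\<bar>v $ i\<bar> < R" using v_less[of i] a by (simp add: d_def e_def split: if_splits)
  have vj: "\<bar>v $ j\<bar> < 1 / K" if "j \<noteq> i" for j
    using v_less[of j] a R K0 that by (simp add: d_def e_def split: if_splits)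
  have "1 / K \<le> R" using K0 R by (simp add: divide_le_eq)
    (metis One_nat_def Suc_leI mult_le_mono nat_mult_1 of_nat_1 of_nat_le_iff of_nat_mult)
  then have short: "\<bar>v $ j\<bar> \<le> R" for j
    using vi vj[of j] by (cases "j = i") auto
  have perp_v: "n \<bullet> v = 0" unfolding v_def by (rule perp) (rule short[unfolded v_def])
  have rest: "(\<Sum>j\<in>UNIV - {i}. \<bar>v $ j\<bar>) \<le> 2 / K"
  proof -
    have "(\<Sum>j\<in>UNIV - {i}. \<bar>v $ j\<bar>) \<le> (\<Sum>j\<in>UNIV - {i}. 1 / K)"
      by (intro sum_mono less_imp_le vj) simp
    also have "\<dots> = 2 / K" by (simp add: card_Diff_singleton)
    finally show ?thesis .
  qed
  have "(\<Sum>j\<in>UNIV. \<bar>v $ j\<bar>) = \<bar>v $ i\<bar> + (\<Sum>j\<in>UNIV - {i}. \<bar>v $ j\<bar>)"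
    by (simp add: sum.remove[of UNIV i])
  \<comment> \<open>The coordinate \<open>i\<close> is at most the sum of the other two, which
    doubles \<open>2 / K\<close>; the 4 in the assumption on \<open>K\<close> comes from
    here.\<close>
  also have "\<dots> \<le> 4 / K" using rest dominated[OF perp_v] by simp
  also have "\<dots> < min 1 c"
    using K K0 pos_divide_less_eq[of "real K" 4 "min 1 c"] by (simp only: mult.commute of_nat_0_less_iff)
  also have "\<dots> \<le> (\<Sum>j\<in>UNIV. \<bar>v $ j\<bar>)"
    unfolding v_def using q(4) R a by (intro approx_vec_long) auto
  finally show False by simp
qed

text \<open>A cube of side \<open>3 * R\<close> in the lattice space, for \<open>s = R * a\<close>,
  is a window of \<open>3 * R * s\<^sup>2\<close> consecutive multiples together with errors of at
  most \<open>3 * R / (2 * s)\<close>. Such a cube contains a lattice vector wherever it is centred,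
  hence the uniformity in \<open>M\<close>.\<close>

lemma multiples_covering:
  "\<exists>C>0. \<forall>a\<ge>1. \<forall>M::nat. \<forall>z\<^sub>1 z\<^sub>2. \<exists>p m\<^sub>1 m\<^sub>2. M < p \<and> real p \<le> M + C * (real a)\<^sup>2 \<and>
     \<bar>real p * \<beta>\<^sub>1 - of_int m\<^sub>1 - z\<^sub>1\<bar> \<le> C / a \<and> \<bar>real p * \<beta>\<^sub>2 - of_int m\<^sub>2 - z\<^sub>2\<bar> \<le> C / a"
proof -
  obtain K :: nat where "4 / min 1 c < K" using reals_Archimedean2 by blast
  then have K: "4 < K * min 1 c" using c_pos by (simp add: field_simps)
  define R where "R = real (K\<^sup>2 + 1)"
  have R: "R \<ge> 1" by (simp add: R_def)
  \<comment> \<open>\<open>3 * R ^ 3\<close> is the window length \<open>3 * R * s\<^sup>2\<close>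
    in units of \<open>a\<^sup>2\<close>; the summand 2 absorbs the offset in
    \<open>M + 1\<close>.\<close>
  define C where "C = 3 * R ^ 3 + 2"
  have C2: "C \<ge> 2" using R by (simp add: C_def)
  have "\<exists>p m\<^sub>1 m\<^sub>2. M < p \<and> real p \<le> M + C * (real a)\<^sup>2 \<and>
     \<bar>real p * \<beta>\<^sub>1 - of_int m\<^sub>1 - z\<^sub>1\<bar> \<le> C / a \<and> \<bar>real p * \<beta>\<^sub>2 - of_int m\<^sub>2 - z\<^sub>2\<bar> \<le> C / a"
    if a: "a \<ge> 1" for a M :: nat and z\<^sub>1 z\<^sub>2
  proof -
    define s where "s = R * a"
    have s: "s > 0" using R a by (simp add: s_def)
    define L where "L = {approx_vec \<beta>\<^sub>1 \<beta>\<^sub>2 s q m\<^sub>1 m\<^sub>2 | q m\<^sub>1 m\<^sub>2. True}"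
    \<comment> \<open>The first coordinate is shifted by the covering radius \<open>3/2 * R\<close>,
      so that the lattice vector found has \<open>q \<ge> M + 1\<close>.\<close>
    define x :: "real^3" where "x = vector [(real M + 1) / s\<^sup>2 + 3/2 * R, s * z\<^sub>1, s * z\<^sub>2]"
    have "\<exists>v\<in>L. \<forall>i. \<bar>x $ i - v $ i\<bar> \<le> CARD(3) * R / 2"
    proof (rule lattice_covering_radius[where x = x])
      have "0 = approx_vec \<beta>\<^sub>1 \<beta>\<^sub>2 s 0 0 0" by (simp add: vec_eq_iff forall_3)
      then show "0 \<in> L" unfolding L_def by blast
    next
      fix x y assume "x \<in> L" "y \<in> L"
      then obtain q m\<^sub>1 m\<^sub>2 q' m\<^sub>1' m\<^sub>2' where "x = approx_vec \<beta>\<^sub>1 \<beta>\<^sub>2 s q m\<^sub>1 m\<^sub>2" "y = approx_vec \<beta>\<^sub>1 \<beta>\<^sub>2 s q' m\<^sub>1' m\<^sub>2'"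
        unfolding L_def by blast
      then have "x + y = approx_vec \<beta>\<^sub>1 \<beta>\<^sub>2 s (q + q') (m\<^sub>1 + m\<^sub>1') (m\<^sub>2 + m\<^sub>2')"
        by (simp add: vec_eq_iff forall_3 algebra_simps add_divide_distrib)
      then show "x + y \<in> L" unfolding L_def by blast
    next
      fix x and k :: int assume "x \<in> L"
      then obtain q m\<^sub>1 m\<^sub>2 where x: "x = approx_vec \<beta>\<^sub>1 \<beta>\<^sub>2 s q m\<^sub>1 m\<^sub>2"
        unfolding L_def by blast
      have "of_int k *\<^sub>R x = approx_vec \<beta>\<^sub>1 \<beta>\<^sub>2 s (k * q) (k * m\<^sub>1) (k * m\<^sub>2)"
        unfolding x by (simp add: vec_eq_iff forall_3 algebra_simps)
      then show "of_int k *\<^sub>R x \<in> L" unfolding L_def by blast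
    next
      fix n :: "real^3" assume n: "\<And>v. v \<in> L \<Longrightarrow> (\<And>i. \<bar>v $ i\<bar> \<le> R) \<Longrightarrow> n \<bullet> v = 0"
      show "n = 0"
      proof (rule short_vectors_spanning[OF K a], fold R_def)
        fix q m\<^sub>1 m\<^sub>2 assume "\<And>i. \<bar>approx_vec \<beta>\<^sub>1 \<beta>\<^sub>2 (R * a) q m\<^sub>1 m\<^sub>2 $ i\<bar> \<le> R"
        then show "n \<bullet> approx_vec \<beta>\<^sub>1 \<beta>\<^sub>2 (R * a) q m\<^sub>1 m\<^sub>2 = 0"
          by (intro n) (auto simp: L_def s_def)
      qed
    qed
    then obtain v where v: "v \<in> L" "\<And>i. \<bar>x $ i - v $ i\<bar> \<le> CARD(3) * R / 2" by blast
    obtain q m\<^sub>1 m\<^sub>2 where q: "v = approx_vec \<beta>\<^sub>1 \<beta>\<^sub>2 s q m\<^sub>1 m\<^sub>2" using v(1) unfolding L_def by blast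
    have q1: "\<bar>(real M + 1) / s\<^sup>2 + 3/2 * R - q / s\<^sup>2\<bar> \<le> 3/2 * R"
      using v(2)[of 1] by (simp add: q x_def)
    then have "(real M + 1) / s\<^sup>2 \<le> q / s\<^sup>2" by linarith
    then have Mq: "real M + 1 \<le> q" using s by (simp add: divide_le_cancel)
    have "q / s\<^sup>2 \<le> (real M + 1) / s\<^sup>2 + 3 * R" using q1 by linarith
    then have "q \<le> real M + 1 + 3 * R * s\<^sup>2" using s by (simp add: field_simps)
    also have "\<dots> \<le> M + C * (real a)\<^sup>2"
    proof -
      have "1 \<le> (real a)\<^sup>2" using a by simp
      moreover have "3 * R * s\<^sup>2 = 3 * R ^ 3 * (real a)\<^sup>2" by (simp add: s_def power2_eq_square power3_eq_cube)
      ultimately show ?thesis by (simp add: C_def distrib_right)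
    qed
    finally have qC: "q \<le> M + C * (real a)\<^sup>2" .
    have close: "\<bar>q * \<beta> - m - z\<bar> \<le> C / a" if "\<bar>s * z - s * (q * \<beta> - m)\<bar> \<le> 3/2 * R" for \<beta> z :: real and m :: int
    proof -
      have "s * \<bar>q * \<beta> - m - z\<bar> = \<bar>s * z - s * (q * \<beta> - m)\<bar>"
        using s by (simp add: abs_mult_pos' abs_minus_commute right_diff_distrib)
      then have "s * \<bar>q * \<beta> - m - z\<bar> \<le> 3/2 * R" using that by simp
      then have "a * \<bar>q * \<beta> - m - z\<bar> \<le> 3/2" using R by (simp add: s_def mult.assoc)
      then have "a * \<bar>q * \<beta> - m - z\<bar> \<le> C" using C2 by simp
      then show ?thesis using a by (simp add: field_simps)
    qed
    have qn: "real_of_int q = real (nat q)" using Mq by simp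
    have "\<bar>q * \<beta>\<^sub>1 - m\<^sub>1 - z\<^sub>1\<bar> \<le> C / a" "\<bar>q * \<beta>\<^sub>2 - m\<^sub>2 - z\<^sub>2\<bar> \<le> C / a"
      using v(2)[of 2] v(2)[of 3] by (auto intro!: close simp: q x_def)
    moreover have "M < nat q" using Mq by simp
    ultimately show ?thesis using qC unfolding qn by blast
  qed
  then show ?thesis using C2 by (intro exI[of _ C]) auto
qed

end

text \<open>The sum of the errors dominates \<open>infnorm\<close>, so the infimum itself serves as
  \<open>c\<close>. The lower bounds are proved separately because a real \<open>INF\<close> can be
  compared with its members only when it is bounded below.\<close>

lemma bad_pair_if_badly_approximable:
  assumes "badly_approximable \<alpha>"
  shows "\<exists>c. bad_pair (\<alpha> $ 1) (\<alpha> $ 2) c"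
proof -
  let ?Z = "{m::real^2. \<forall>i. m $ i \<in> \<int>}"
  let ?I = "\<lambda>q::nat. INF m\<in>?Z. infnorm (real q *\<^sub>R \<alpha> - m)"
  define c where "c = (INF q\<in>{1::nat..}. sqrt (real q) * ?I q)"
  have bdd: "bdd_below ((\<lambda>m. infnorm (real q *\<^sub>R \<alpha> - m)) ` ?Z)" for q :: nat
    by (rule bdd_belowI2[of _ 0]) (rule infnorm_pos_le)
  have "(0::real^2) \<in> ?Z" by simp
  then have "?I q \<ge> 0" for q by (intro cINF_greatest) (blast, rule infnorm_pos_le)
  then have bdd': "bdd_below ((\<lambda>q::nat. sqrt (real q) * ?I q) ` {1..})"
    by (intro bdd_belowI2[of _ 0]) simp
  have "bad_pair (\<alpha> $ 1) (\<alpha> $ 2) c"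
  proof
    show "c > 0" using assms unfolding badly_approximable_def c_def .
    fix q :: nat and m\<^sub>1 m\<^sub>2 :: int assume q: "1 \<le> q"
    let ?m = "vector [of_int m\<^sub>1, of_int m\<^sub>2] :: real^2"
    have "c \<le> sqrt q * ?I q" unfolding c_def using bdd' q by (intro cINF_lower) auto
    also have "?I q \<le> infnorm (real q *\<^sub>R \<alpha> - ?m)"
      by (intro cINF_lower bdd) (simp add: forall_2)
    also have "\<dots> \<le> norm (real q *\<^sub>R \<alpha> - ?m)" by (rule infnorm_le_norm)
    also have "\<dots> \<le> (\<Sum>i\<in>UNIV. \<bar>(real q *\<^sub>R \<alpha> - ?m) $ i\<bar>)" by (rule norm_le_l1_cart)
    finally show "c \<le> sqrt q * (\<bar>q * \<alpha> $ 1 - m\<^sub>1\<bar> + \<bar>q * \<alpha> $ 2 - m\<^sub>2\<bar>)"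
      by (simp add: sum_2 mult_left_mono)
  qed
  then show ?thesis ..
qed

text \<open>If both products were integers, both coordinates of \<alpha> would be integer multiples
  of \<open>\<theta> = 1 / t\<close>. Dirichlet's theorem for the single number \<theta> gives
  errors of order \<open>1 / N\<close> with \<open>q \<le> N\<close>, which beats the admissible
  order \<open>1 / sqrt N\<close>.\<close>

lemma badly_approximable_irrational:
  assumes "badly_approximable \<alpha>" "t > 0" "t * \<alpha> $ 1 \<in> \<int>"
  shows "t * \<alpha> $ 2 \<notin> \<int>"
proof
  assume int: "t * \<alpha> $ 2 \<in> \<int>"
  obtain c where "bad_pair (\<alpha> $ 1) (\<alpha> $ 2) c"
    using bad_pair_if_badly_approximable[OF assms(1)] by blast
  note c = bad_pair.c_pos[OF this] bad_pair.bad[OF this]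
  obtain i j :: int where ij: "t * \<alpha> $ 1 = i" "t * \<alpha> $ 2 = j"
    using assms(3) int by (auto elim!: Ints_cases)
  define \<theta> where "\<theta> = 1 / t"
  have \<alpha>: "\<alpha> $ 1 = i * \<theta>" "\<alpha> $ 2 = j * \<theta>" using ij assms(2) by (simp_all add: \<theta>_def field_simps)
  define J where "J = \<bar>real_of_int i\<bar> + \<bar>real_of_int j\<bar>"
  obtain N :: nat where N: "(J / c)\<^sup>2 < N" using reals_Archimedean2 by blast
  then have N0: "N > 0" by (metis of_nat_0_less_iff order_le_less_trans zero_le_power2)
  obtain p q where q: "0 < q" "q \<le> int N" "\<bar>of_int q * \<theta> - of_int p\<bar> < 1 / N"
    using Dirichlet_approx[OF N0] by blast
  define n where "n = nat q"
  have n: "1 \<le> n" "n \<le> N" "real_of_int q = real n" using q by (auto simp: n_def)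
  have close: "\<bar>n * \<theta> - p\<bar> \<le> 1 / N" using q(3) n by simp
  have "c \<le> sqrt n * (\<bar>n * \<alpha> $ 1 - of_int (i * p)\<bar> + \<bar>n * \<alpha> $ 2 - of_int (j * p)\<bar>)"
    by (rule c(2)[OF n(1)])
  also have "\<bar>n * \<alpha> $ 1 - of_int (i * p)\<bar> = \<bar>i\<bar> * \<bar>n * \<theta> - p\<bar>"
    unfolding \<alpha> of_int_abs abs_mult[symmetric] by (simp add: algebra_simps)
  also have "\<bar>n * \<alpha> $ 2 - of_int (j * p)\<bar> = \<bar>j\<bar> * \<bar>n * \<theta> - p\<bar>"
    unfolding \<alpha> of_int_abs abs_mult[symmetric] by (simp add: algebra_simps)
  also have "sqrt n * (\<bar>i\<bar> * \<bar>n * \<theta> - p\<bar> + \<bar>j\<bar> * \<bar>n * \<theta> - p\<bar>) = sqrt n * (J * \<bar>n * \<theta> - p\<bar>)"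
    by (simp add: J_def distrib_right)
  also have "\<dots> \<le> sqrt N * (J * (1 / N))"
    using n close by (intro mult_mono) (auto simp: J_def)
  also have "\<dots> = J / sqrt N"
    using N0 by (simp add: field_simps)
  finally have "c * sqrt N \<le> J" using N0 by (simp add: field_simps)
  then have "sqrt N \<le> J / c" using c by (simp add: field_simps)
  moreover have "J / c < sqrt N" using N by (simp add: real_less_rsqrt)
  ultimately show False by simp
qed

subsection \<open>The greedy sequence\<close>

lemma norm_diff_unit:
  fixes u w :: "'a::real_inner"
  assumes "norm u = 1" "norm w = 1"
  shows "(norm (u - w))\<^sup>2 = 2 - 2 * (u \<bullet> w)" "\<bar>u \<bullet> w\<bar> \<le> 1"
proof -
  show "(norm (u - w))\<^sup>2 = 2 - 2 * (u \<bullet> w)"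
    using assms by (simp add: power2_norm_eq_inner inner_diff_left inner_diff_right inner_commute norm_eq_1)
  show "\<bar>u \<bullet> w\<bar> \<le> 1" using Cauchy_Schwarz_ineq2[of u w] assms by simp
qed

text \<open>The chord of an arc of length \<theta> is \<open>2 * sin (\<theta>/2)\<close>.\<close>

lemma chord_le_arccos:
  fixes u w :: "'a::real_inner"
  assumes "norm u = 1" "norm w = 1"
  shows "norm (u - w) \<le> arccos (u \<bullet> w)"
proof -
  define \<theta> where "\<theta> = arccos (u \<bullet> w)"
  have \<theta>: "0 \<le> \<theta>" "cos \<theta> = u \<bullet> w"
    using norm_diff_unit(2)[OF assms] arccos_lbound[of "u \<bullet> w"] by (auto simp: \<theta>_def)
  have "(norm (u - w))\<^sup>2 = 4 * (sin (\<theta>/2))\<^sup>2"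
    using norm_diff_unit(1)[OF assms] cos_double_sin[of "\<theta>/2"] \<theta> by simp
  also have "\<dots> \<le> 4 * (\<theta>/2)\<^sup>2"
    using abs_sin_x_le_abs_x[of "\<theta>/2"] unfolding abs_le_square_iff by (rule mult_left_mono) simp
  also have "\<dots> = \<theta>\<^sup>2" by (simp add: power2_eq_square)
  finally show ?thesis using \<theta>(1) unfolding \<theta>_def by (rule power2_le_imp_le)
qed

lemma half_le_sin:
  fixes y :: real
  assumes "0 \<le> y" "y \<le> 1"
  shows "y / 2 \<le> sin y"
proof (cases "y = 0")
  case False
  then have "0 < y" using assms by simp
  then obtain z where z: "z > 0" "z < y" "sin y - sin 0 = (y - 0) * cos z"
    using MVT2[of 0 y sin cos] DERIV_sin by blast
  have "cos (pi/3) \<le> cos z"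
    using z assms pi_gt3 by (intro cos_monotone_0_pi_le) auto
  then have "1/2 \<le> cos z" by (simp add: cos_60)
  then have "y * (1/2) \<le> y * cos z" using assms by (intro mult_left_mono) auto
  then show ?thesis using z by simp
qed simp

text \<open>Converse comparison, with a crude factor: for arcs up to 1,
  \<open>sin y \<ge> y / 2\<close> suffices.\<close>

lemma chord_ge_half:
  fixes u w :: "'a::real_inner"
  assumes "norm u = 1" "norm w = 1" "0 \<le> \<rho>" "\<rho> \<le> 1" "\<rho> < arccos (u \<bullet> w)"
  shows "\<rho> / 2 \<le> norm (u - w)"
proof -
  have "u \<bullet> w < cos \<rho>"
  proof -
    have "cos (arccos (u \<bullet> w)) < cos \<rho>"
      using assms norm_diff_unit(2)[OF assms(1,2)] by (intro cos_monotone_0_pi arccos_ubound) auto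
    then show ?thesis using norm_diff_unit(2)[OF assms(1,2)] by simp
  qed
  then have "4 * (sin (\<rho>/2))\<^sup>2 \<le> (norm (u - w))\<^sup>2"
    using norm_diff_unit(1)[OF assms(1,2)] cos_double_sin[of "\<rho>/2"] by simp
  moreover have "(\<rho>/4)\<^sup>2 \<le> (sin (\<rho>/2))\<^sup>2"
    using half_le_sin[of "\<rho>/2"] assms by (intro power_mono) auto
  ultimately have "(\<rho>/2)\<^sup>2 \<le> (norm (u - w))\<^sup>2" by (simp add: power2_eq_square)
  then show ?thesis by (rule power2_le_imp_le) simp
qed

text \<open>A square grid in a plane, lifted to the upper hemisphere; coordinates up to 1/2 keep the
  square root real, and projection does not increase distances. The grid has
  \<open>(n + 1)\<^sup>2\<close> points, more than the at most \<open>n\<^sup>2\<close> caps it is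
  compared with.\<close>

lemma separated_unit_vectors:
  fixes n :: nat
  assumes "1 \<le> n"
  obtains g :: "nat \<times> nat \<Rightarrow> real^3" where
    "\<And>p. p \<in> {..n} \<times> {..n} \<Longrightarrow> norm (g p) = 1"
    "\<And>p q. p \<in> {..n} \<times> {..n} \<Longrightarrow> q \<in> {..n} \<times> {..n} \<Longrightarrow> p \<noteq> q \<Longrightarrow> 1 / (2 * n) \<le> norm (g p - g q)"
proof
  let ?c = "\<lambda>i. real i / (2 * n)"
  let ?g = "\<lambda>(i, j). vector [?c i, ?c j, sqrt (1 - (?c i)\<^sup>2 - (?c j)\<^sup>2)] :: real^3"
  show "norm (?g p) = 1" if pn: "p \<in> {..n} \<times> {..n}" for p
  proof -
    obtain i j where p: "p = (i, j)" "i \<le> n" "j \<le> n" using pn by auto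
    have half: "(?c i)\<^sup>2 \<le> (1/2)\<^sup>2" if "i \<le> n" for i
      using that assms by (intro power_mono) (auto simp: field_simps)
    have "norm (vector [a, b, sqrt (1 - a\<^sup>2 - b\<^sup>2)] :: real^3) = 1" if "a\<^sup>2 \<le> (1/2)\<^sup>2" "b\<^sup>2 \<le> (1/2)\<^sup>2" for a b :: real
    proof -
      have "0 \<le> 1 - a\<^sup>2 - b\<^sup>2" using that unfolding power2_eq_square[of "1/2"] by linarith
      then show ?thesis by (simp add: norm_vec_def L2_set_def sum_3)
    qed
    from this[OF half half] show ?thesis using p by simp
  qed
  show "1 / (2 * n) \<le> norm (?g p - ?g q)" if ne: "p \<noteq> q" for p q
  proof -
    obtain i j i' j' where pq: "p = (i, j)" "q = (i', j')" by (metis surj_pair)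
    have sep: "1 / (2 * n) \<le> \<bar>?c i - ?c i'\<bar>" if "i \<noteq> i'" for i i'
    proof -
      have "1 \<le> \<bar>real i - real i'\<bar>" using that by linarith
      then have "1 / (2 * n) \<le> \<bar>real i - real i'\<bar> / (2 * n)" by (intro divide_right_mono) auto
      then show ?thesis by (simp add: abs_divide flip: diff_divide_distrib)
    qed
    have "\<bar>?c i - ?c i'\<bar> \<le> norm (?g p - ?g q)" "\<bar>?c j - ?c j'\<bar> \<le> norm (?g p - ?g q)"
      using component_le_norm_cart[of "?g p - ?g q" 1] component_le_norm_cart[of "?g p - ?g q" 2]
      by (simp_all add: pq)
    then show ?thesis using ne sep[of i i'] sep[of j j'] unfolding pq by force
  qed
qed

lemma cbrt_powr:
  assumes "k \<ge> 1"
  shows "real k powr (1/3) = root 3 k" "real k powr (2/3) = (root 3 k)\<^sup>2"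
proof -
  show 1: "real k powr (1/3) = root 3 k"
    using root_powr_inverse[of 3 "real k"] by simp
  have "real k powr (2/3) = (real k powr (1/3)) powr 2" by (simp add: powr_powr)
  also have "\<dots> = (root 3 k)\<^sup>2" unfolding 1 using assms by (simp add: powr_realpow flip: powr_numeral)
  finally show "real k powr (2/3) = (root 3 k)\<^sup>2" .
qed

lemma cbrt_cube: "(root 3 (real k)) ^ 3 = real k"
  by (simp add: odd_real_root_pow)

lemma excluded_region_iff:
  assumes "k \<ge> 1" "norm y = 1"
  shows "y \<in> excluded_region \<gamma> k u \<longleftrightarrow>
    (\<exists>m\<ge>1. real m < (root 3 k)\<^sup>2 \<and> arccos (y \<bullet> u (k - m)) \<le> \<gamma> / root 3 k)"
  using assms by (auto simp: excluded_region_def spherical_cap_def cbrt_powr)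

text \<open>Keeps \<open>k - m\<close> positive, so that truncated subtraction never produces the
  index 0.\<close>

lemma less_cube_root_square:
  assumes "real m < (root 3 (real k))\<^sup>2" "k \<ge> 1"
  shows "m < k"
proof -
  have "(root 3 (real k))\<^sup>2 \<le> (root 3 (real k)) ^ 3"
    using assms by (intro power_increasing) auto
  then show ?thesis using assms by (simp add: cbrt_cube)
qed

locale covering_sequence =
  fixes x :: "nat \<Rightarrow> real^3" and C :: real
  assumes unit: "norm (x p) = 1" and C_pos: "C > 0"
    and covering: "(1::nat) \<le> a \<Longrightarrow> norm w = 1 \<Longrightarrow> \<exists>p>M::nat. real p \<le> M + C * (real a)\<^sup>2 \<and> norm (x p - w) \<le> C / a"

text \<open>Among more than \<open>k powr (2/3)\<close> unit vectors that are pairwise far apart compared with the radius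
  of the caps, one avoids all the caps with a margin; a point of the sequence close to it is admissible.\<close>

lemma (in covering_sequence) exists_admissible:
  assumes "k \<ge> 1" "0 < \<gamma>" "\<gamma> < 1/16" and u: "\<And>i. norm (u i) = 1"
  shows "\<exists>p>M. x p \<notin> excluded_region \<gamma> k u"
proof -
  define b where "b = root 3 (real k)"
  define \<rho> where "\<rho> = \<gamma> / b"
  \<comment> \<open>Rounded up so that \<open>n\<^sup>2\<close> bounds the number of caps, while
    \<open>n \<le> 2 * b\<close> keeps the grid spacing of order \<open>1 / b\<close>.\<close>
  define n where "n = nat \<lceil>b\<rceil>"
  have b: "b \<ge> 1" using assms by (simp add: b_def)
  have \<rho>: "\<rho> > 0" using b assms by (simp add: \<rho>_def)
  have n: "1 \<le> n" "b \<le> n" "n \<le> 2 * b" using b unfolding n_def by linarith+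
  obtain g :: "nat \<times> nat \<Rightarrow> real^3" where g:
    "\<And>p. p \<in> {..n} \<times> {..n} \<Longrightarrow> norm (g p) = 1"
    "\<And>p q. p \<in> {..n} \<times> {..n} \<Longrightarrow> q \<in> {..n} \<times> {..n} \<Longrightarrow> p \<noteq> q \<Longrightarrow> 1 / (2 * n) \<le> norm (g p - g q)"
    using separated_unit_vectors[OF n(1)] by blast
  have "\<exists>p\<in>{..n} \<times> {..n}. \<forall>m\<ge>1. real m < b\<^sup>2 \<longrightarrow> 2 * \<rho> < norm (g p - u (k - m))"
  proof (rule ccontr)
    assume "\<not> ?thesis"
    then have "\<forall>p\<in>{..n} \<times> {..n}. \<exists>m. m \<ge> 1 \<and> real m < b\<^sup>2 \<and> norm (g p - u (k - m)) \<le> 2 * \<rho>"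
      by (meson not_le)
    then obtain h where h: "\<And>p. p \<in> {..n} \<times> {..n} \<Longrightarrow> h p \<ge> 1 \<and> real (h p) < b\<^sup>2 \<and> norm (g p - u (k - h p)) \<le> 2 * \<rho>"
      by metis
    have "h ` ({..n} \<times> {..n}) \<subseteq> {1..n\<^sup>2}"
    proof
      fix m assume "m \<in> h ` ({..n} \<times> {..n})"
      then have m: "m \<ge> 1" "real m < b\<^sup>2" using h by auto
      have "b\<^sup>2 \<le> (real n)\<^sup>2" using n b by (intro power_mono) auto
      then have "real m < real (n\<^sup>2)" using m unfolding of_nat_power by linarith
      then have "m < n\<^sup>2" by (rule of_nat_less_imp_less)
      then show "m \<in> {1..n\<^sup>2}" using m by simp
    qed
    then have "card (h ` ({..n} \<times> {..n})) \<le> card {1..n\<^sup>2}" by (intro card_mono) auto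
    also have "\<dots> < card ({..n} \<times> {..n})" by (simp add: card_cartesian_product power2_eq_square)
    finally have "\<not> inj_on h ({..n} \<times> {..n})" by (rule pigeonhole)
    then obtain p q where pq: "p \<in> {..n} \<times> {..n}" "q \<in> {..n} \<times> {..n}" "h p = h q" "p \<noteq> q"
      unfolding inj_on_def by blast
    have "norm (g p - g q) \<le> norm (g p - u (k - h p)) + norm (g q - u (k - h p))"
      using norm_triangle_ineq4[of "g p - u (k - h p)" "g q - u (k - h p)"] by simp
    also have "\<dots> \<le> 4 * \<rho>" using h[OF pq(1)] h[OF pq(2)] pq(3) by simp
    \<comment> \<open>Two grid points near the same centre would be this close; here
      \<open>\<gamma> < 1/16\<close> enters, and the spacing \<open>1 / (2 * n)\<close> is
      contradicted.\<close>
    also have "\<dots> < 1 / (4 * b)" using assms b by (simp add: \<rho>_def field_simps)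
    also have "\<dots> \<le> 1 / (2 * n)" using n b by (intro divide_left_mono) auto
    finally show False using g(2)[OF pq(1,2,4)] by simp
  qed
  then obtain p where p: "p \<in> {..n} \<times> {..n}" "\<And>m. m \<ge> 1 \<Longrightarrow> real m < b\<^sup>2 \<Longrightarrow> 2 * \<rho> < norm (g p - u (k - m))"
    by blast
  \<comment> \<open>Fine enough that the candidate is within \<rho> of \<open>g p\<close>; of the
    margin \<open>2 * \<rho>\<close>, the other \<rho> is the radius of the cap.\<close>
  define a where "a = nat \<lceil>C / \<rho>\<rceil>"
  have "C / \<rho> > 0" using C_pos \<rho> by simp
  then have a: "1 \<le> a" "C / \<rho> \<le> a" unfolding a_def by linarith+
  then have a': "C / a \<le> \<rho>" using \<rho> by (simp add: field_simps)
  obtain r where r: "r > M" "norm (x r - g p) \<le> C / a"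
    using covering[OF a(1) g(1)[OF p(1)]] by blast
  have "x r \<notin> excluded_region \<gamma> k u"
  proof
    assume "x r \<in> excluded_region \<gamma> k u"
    then obtain m where m: "m \<ge> 1" "real m < b\<^sup>2" "arccos (x r \<bullet> u (k - m)) \<le> \<rho>"
      unfolding excluded_region_iff[OF assms(1) unit] b_def \<rho>_def by blast
    have "norm (g p - u (k - m)) \<le> norm (x r - g p) + norm (x r - u (k - m))"
      using norm_triangle_ineq4[of "x r - u (k - m)" "x r - g p"] by simp
    also have "\<dots> \<le> \<rho> + \<rho>"
      using r(2) a' m(3) chord_le_arccos[OF unit u, of r "k - m"] by linarith
    finally show False using p(2)[OF m(1,2)] by simp
  qed
  then show ?thesis using r(1) by blast
qed

locale greedy = covering_sequence +
  fixes \<gamma> :: real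
  assumes \<gamma>: "0 < \<gamma>" "\<gamma> < 1/16"
begin

abbreviation j where "j \<equiv> greedy_index x \<gamma>"
abbreviation u where "u \<equiv> \<lambda>k. x (j k)"

lemma j_step:
  assumes "k \<ge> 2"
  shows "j (k - 1) < j k" "x (j k) \<notin> excluded_region \<gamma> k u"
    "\<And>p. j (k - 1) < p \<Longrightarrow> p < j k \<Longrightarrow> x p \<in> excluded_region \<gamma> k u"
proof -
  let ?P = "\<lambda>p. p > j (k - 1) \<and> x p \<notin> excluded_region \<gamma> k u"
  have j: "j k = (LEAST p. ?P p)"
    using assms by (subst greedy_index.simps) simp
  have "\<exists>p. ?P p" using exists_admissible[of k \<gamma> u] assms \<gamma> unit by simp
  then have "?P (j k)" unfolding j by (rule LeastI_ex)
  then show "j (k - 1) < j k" "x (j k) \<notin> excluded_region \<gamma> k u" by blast+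
  fix p assume "j (k - 1) < p" "p < j k"
  then show "x p \<in> excluded_region \<gamma> k u"
    using not_less_Least[of p ?P] unfolding j by blast
qed

text \<open>Strict growth, used to bound indices from above: a candidate at most \<open>l\<close>
  places after \<open>j k\<close> is passed no later than at index \<open>k + l\<close>.\<close>

lemma j_add: "k \<ge> 1 \<Longrightarrow> j k + l \<le> j (k + l)"
proof (induction l)
  case (Suc l)
  then show ?case using j_step(1)[of "Suc (k + l)"] by simp
qed simp

text \<open>If \<open>l\<close> is in the window of \<open>k\<close>, the cap around
  \<open>u l\<close> excludes \<open>u k\<close> and separation is tangential; if not, it is
  radial.\<close>

lemma separated:
  assumes "1 \<le> l" "l < k"
  shows "\<gamma> / 4 \<le> dist (root 3 k *\<^sub>R u k) (root 3 l *\<^sub>R u l)"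
proof -
  define a b where "a = root 3 (real k)" and "b = root 3 (real l)"
  define \<delta> where "\<delta> = norm (a *\<^sub>R u k - b *\<^sub>R u l)"
  have b: "1 \<le> b" "b \<le> a" using assms by (simp_all add: a_def b_def)
  have radial: "a - b \<le> \<delta>"
    using norm_triangle_ineq2[of "a *\<^sub>R u k" "b *\<^sub>R u l"] b unit by (simp add: \<delta>_def)
  have "\<gamma> / 4 \<le> \<delta>"
  proof (cases "real (k - l) < a\<^sup>2")
    case True
    have "\<gamma> / a < arccos (u k \<bullet> u l)"
    proof (rule ccontr)
      assume "\<not> ?thesis"
      then have "u k \<in> excluded_region \<gamma> k u"
        using assms True
        by (subst excluded_region_iff[OF _ unit]) (auto intro!: exI[of _ "k - l"] simp: a_def)
      then show False using j_step(2)[of k] assms by simp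
    qed
    moreover have "\<gamma> / a \<le> 1" using \<gamma> b by (simp add: field_simps)
    ultimately have "\<gamma> / a / 2 \<le> norm (u k - u l)"
      using \<gamma> b unit by (intro chord_ge_half) auto
    then have "\<gamma> / 2 \<le> a * norm (u k - u l)" using b by (simp add: field_simps)
    also have "\<dots> = norm (a *\<^sub>R (u k - u l))" using b by simp
    \<comment> \<open>Comparison with the same radius \<open>a\<close> costs \<open>a - b\<close>,
      itself at most \<delta>; hence \<open>\<gamma> / 2 \<le> 2 * \<delta>\<close>.\<close>
    also have "a *\<^sub>R (u k - u l) = (a *\<^sub>R u k - b *\<^sub>R u l) - (a - b) *\<^sub>R u l"
      by (simp add: algebra_simps)
    also have "norm \<dots> \<le> \<delta> + (a - b)"
      unfolding \<delta>_def using b unit by (intro order_trans[OF norm_triangle_ineq4]) simp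
    finally show ?thesis using radial by simp
  next
    case False
    have "a\<^sup>2 \<le> a ^ 3 - b ^ 3"
      using False assms by (simp add: a_def b_def cbrt_cube of_nat_diff)
    also have "\<dots> = (a - b) * (a\<^sup>2 + a * b + b\<^sup>2)"
      by (simp add: power2_eq_square power3_eq_cube algebra_simps)
    also have "\<dots> \<le> (a - b) * (3 * a\<^sup>2)"
    proof -
      have "a * b \<le> a\<^sup>2" "b\<^sup>2 \<le> a\<^sup>2" using b by (auto simp: power2_eq_square intro: mult_mono)
      then have "a\<^sup>2 + a * b + b\<^sup>2 \<le> 3 * a\<^sup>2" by linarith
      then show ?thesis using b by (intro mult_left_mono) auto
    qed
    finally have "a\<^sup>2 * 1 \<le> a\<^sup>2 * (3 * (a - b))" by (simp add: algebra_simps)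
    then have "1 \<le> 3 * (a - b)" using b by (subst (asm) mult_le_cancel_left_pos) auto
    then show ?thesis using radial \<gamma> by simp
  qed
  then show ?thesis by (simp add: \<delta>_def a_def b_def dist_norm)
qed

text \<open>Every candidate point between two consecutive selected ones is excluded, hence lies in a small cap
  around a recently selected point. So a block of about \<open>k powr (2/3)\<close> consecutive indices
  selects points as dense on the sphere as the candidate points of that block.\<close>

lemma relatively_dense: "\<exists>K. \<forall>y. \<exists>k\<ge>1. dist y (root 3 k *\<^sub>R u k) \<le> K"
proof -
  \<comment> \<open>Radial thickness of the index block: \<open>4 * C\<close> comes from
    \<open>a \<le> 2 * r\<close>, the remainder absorbs the two roundings up.\<close>
  define E where "E = 4 * C + 3"
  have E: "E > 0" using C_pos by (simp add: E_def)
  \<comment> \<open>\<open>C + \<gamma>\<close> is the tangential error,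
    \<open>(1 + E)\<^sup>2\<close> the radial one, and 2 serves the points of norm below 1.\<close>
  define K where "K = C + \<gamma> + (1 + E)\<^sup>2 + 2"
  \<comment> \<open>Turns differences of indices of order \<open>r\<^sup>2\<close> into bounded
    differences of radii.\<close>
  have cube_diff: "\<bar>b - r\<bar> \<le> F" if "\<bar>b ^ 3 - r ^ 3\<bar> \<le> F * r\<^sup>2" "0 \<le> b" "1 \<le> r" for b r F :: real
  proof -
    have "b ^ 3 - r ^ 3 = (b - r) * (b\<^sup>2 + b * r + r\<^sup>2)"
      by (simp add: power2_eq_square power3_eq_cube algebra_simps)
    then have "\<bar>b ^ 3 - r ^ 3\<bar> = \<bar>b - r\<bar> * (b\<^sup>2 + b * r + r\<^sup>2)"
      using that by (simp add: abs_mult)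
    moreover have "\<bar>b - r\<bar> * r\<^sup>2 \<le> \<bar>b - r\<bar> * (b\<^sup>2 + b * r + r\<^sup>2)"
      using that by (intro mult_left_mono) auto
    ultimately have "\<bar>b - r\<bar> * r\<^sup>2 \<le> F * r\<^sup>2" using that by linarith
    then show ?thesis by (rule mult_right_le_imp_le) (use that in simp)
  qed
  have "\<exists>k\<ge>1. dist y (root 3 k *\<^sub>R u k) \<le> K" for y :: "real^3"
  proof (cases "norm y < 1")
    case True
    have "dist y (root 3 (real 1) *\<^sub>R u 1) \<le> norm y + norm (u 1)"
      by (simp add: dist_norm norm_triangle_ineq4)
    also have "\<dots> \<le> 2" using True unit[of "j 1"] by simp
    also have "\<dots> \<le> K" using C_pos \<gamma> by (simp add: K_def)
    finally show ?thesis by blast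
  next
    case False
    define r where "r = norm y"
    have r: "r \<ge> 1" using False by (simp add: r_def)
    define w where "w = y /\<^sub>R r"
    have w: "norm w = 1" "y = r *\<^sub>R w" using r by (simp_all add: w_def flip: r_def)
    define k0 where "k0 = nat \<lceil>r ^ 3\<rceil>"
    have r3: "r ^ 3 \<ge> 1" using r by simp
    then have k0: "k0 \<ge> 1" "r ^ 3 \<le> k0" "k0 \<le> r ^ 3 + 1" unfolding k0_def by linarith+
    define a where "a = nat \<lceil>r\<rceil>"
    have a: "1 \<le> a" "r \<le> a" "a \<le> 2 * r" using r unfolding a_def by linarith+
    define L where "L = nat \<lceil>C * (real a)\<^sup>2\<rceil>"
    have "C * (real a)\<^sup>2 \<ge> 0" using C_pos by simp
    then have L: "C * (real a)\<^sup>2 \<le> L" "L \<le> C * (real a)\<^sup>2 + 1" unfolding L_def by linarith+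
    have "(real a)\<^sup>2 \<le> (2 * r)\<^sup>2" using a by (intro power_mono) auto
    then have "C * (real a)\<^sup>2 \<le> C * (4 * r\<^sup>2)" using C_pos by (simp add: power_mult_distrib)
    moreover have r2: "1 \<le> r\<^sup>2" using r by simp
    ultimately have LE: "k0 + L \<le> r ^ 3 + E * r\<^sup>2"
      using L(2) k0(3) unfolding E_def by (simp add: algebra_simps)
    obtain p where p: "p > j k0" "real p \<le> j k0 + C * (real a)\<^sup>2" "norm (x p - w) \<le> C / a"
      using covering[OF a(1) w(1)] by blast
    have "real p \<le> real (j k0 + L)" using p(2) L(1) by simp
    then have pL: "p \<le> j (k0 + L)" using j_add[OF k0(1), of L] by linarith
    \<comment> \<open>The step of the selection during which \<open>p\<close> is examined:
      \<open>p\<close> lies after \<open>j (k - 1)\<close> and not after \<open>j k\<close>.\<close>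
    define k where "k = (LEAST k. k0 \<le> k \<and> p \<le> j k)"
    have k: "k0 \<le> k" "p \<le> j k"
      using LeastI[of "\<lambda>k. k0 \<le> k \<and> p \<le> j k" "k0 + L"] pL unfolding k_def by auto
    have kL: "k \<le> k0 + L" unfolding k_def using pL by (intro Least_le) auto
    \<comment> \<open>Hence \<open>k - 1\<close> is still at least \<open>k0\<close>, which the
      minimality of \<open>k\<close> needs in order to give \<open>j (k - 1) < p\<close>.\<close>
    have "k \<noteq> k0" using k p(1) by auto
    then have k2: "k > k0" "k \<ge> 2" using k k0(1) by auto
    have pk: "j (k - 1) < p"
    proof (rule ccontr)
      assume "\<not> ?thesis"
      then show False
        using k2 not_less_Least[of "k - 1" "\<lambda>k. k0 \<le> k \<and> p \<le> j k"] unfolding k_def[symmetric] by auto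
    qed
    define b where "b = root 3 (real k)"
    have b3: "b ^ 3 = k" by (simp add: b_def cbrt_cube)
    have b0: "b \<ge> 0" by (simp add: b_def)
    have "r ^ 3 \<le> b ^ 3" using b3 k0(2) k(1) by simp
    then have rb: "r \<le> b" using b0 r power_mono_iff[of r b 3] by simp
    have kE: "real k \<le> r ^ 3 + E * r\<^sup>2" using LE kL by linarith
    have "\<bar>b ^ 3 - r ^ 3\<bar> \<le> E * r\<^sup>2" using kE \<open>r ^ 3 \<le> b ^ 3\<close> b3 by linarith
    then have "\<bar>b - r\<bar> \<le> E" using b0 r by (rule cube_diff)
    then have "b \<le> r + E" by linarith
    also have "\<dots> \<le> (1 + E) * r" using r E by (simp add: algebra_simps)
    finally have "b\<^sup>2 \<le> ((1 + E) * r)\<^sup>2" using b0 by (intro power_mono) auto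
    then have b2: "b\<^sup>2 \<le> (1 + E)\<^sup>2 * r\<^sup>2" by (simp add: power_mult_distrib)
    \<comment> \<open>Either \<open>p\<close> is selected itself, or it lies in a cap around one of
      the points selected within the last \<open>b\<^sup>2\<close> indices.\<close>
    obtain k' where k': "1 \<le> k'" "k' \<le> k" "real k - b\<^sup>2 \<le> real k'" "norm (x p - u k') \<le> \<gamma> / b"
    proof (cases "p = j k")
      case True
      then show ?thesis using that[of k] k2 rb r \<gamma> by auto
    next
      case False
      then have "x p \<in> excluded_region \<gamma> k u"
        using j_step(3)[OF k2(2) pk] k by simp
      then obtain m where m: "m \<ge> 1" "real m < b\<^sup>2" "arccos (x p \<bullet> u (k - m)) \<le> \<gamma> / b"
        using excluded_region_iff[OF _ unit, of k] k2 unfolding b_def by auto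
      have "m < k" using less_cube_root_square m(2) k2 unfolding b_def by auto
      moreover have "norm (x p - u (k - m)) \<le> \<gamma> / b"
        using chord_le_arccos[OF unit unit, of p "j (k - m)"] m(3) by linarith
      ultimately show ?thesis using m by (intro that[of "k - m"]) (auto simp: of_nat_diff)
    qed
    define b' where "b' = root 3 (real k')"
    have b': "b' ^ 3 = k'" "b' \<ge> 0" by (simp_all add: b'_def cbrt_cube)
    have "\<bar>b' ^ 3 - r ^ 3\<bar> \<le> (1 + E)\<^sup>2 * r\<^sup>2"
    proof -
      have "E * r\<^sup>2 \<le> (1 + E)\<^sup>2 * r\<^sup>2" using E by (intro mult_right_mono) (auto simp: power2_eq_square algebra_simps)
      moreover have "real k' \<le> real k" using k'(2) by simp
      moreover have "r ^ 3 \<le> real k" using k0(2) k(1) by simp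
      ultimately show ?thesis unfolding b'(1) using kE k'(3) b2 by linarith
    qed
    then have br: "\<bar>b' - r\<bar> \<le> (1 + E)\<^sup>2" using b'(2) r by (rule cube_diff)
    have wu: "norm (w - u k') \<le> C / r + \<gamma> / r"
    proof -
      have "norm (w - u k') \<le> norm (x p - u k') + norm (x p - w)"
        using norm_triangle_ineq4[of "x p - u k'" "x p - w"] by simp
      moreover have "C / a \<le> C / r" using a r C_pos by (intro divide_left_mono) auto
      moreover have "\<gamma> / b \<le> \<gamma> / r" using rb r \<gamma> by (intro divide_left_mono) auto
      ultimately show ?thesis using p(3) k'(4) by linarith
    qed
    have "y - b' *\<^sub>R u k' = r *\<^sub>R (w - u k') + (r - b') *\<^sub>R u k'"
      by (simp add: w(2) algebra_simps)
    then have "dist y (b' *\<^sub>R u k') \<le> norm (r *\<^sub>R (w - u k')) + norm ((r - b') *\<^sub>R u k')"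
      unfolding dist_norm by (metis norm_triangle_ineq)
    also have "\<dots> = r * norm (w - u k') + \<bar>b' - r\<bar>" using r unit by (simp add: abs_minus_commute)
    also have "\<dots> \<le> r * (C / r + \<gamma> / r) + (1 + E)\<^sup>2"
      using wu br r by (intro add_mono mult_left_mono) auto
    also have "\<dots> \<le> K" using r by (simp add: K_def distrib_left)
    finally show ?thesis using k'(1) unfolding b'_def by blast
  qed
  then show ?thesis by blast
qed

lemma delone_spiral: "delone {root 3 (real k) *\<^sub>R u k |k. 1 \<le> k}" (is "delone ?S")
  unfolding delone_def
proof (intro conjI)
  show "uniform_discrete ?S"
  proof (rule uniformI2)
    show "\<gamma> / 4 > 0" using \<gamma> by simp
    fix y z assume "y \<in> ?S" "z \<in> ?S" "y \<noteq> z"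
    then obtain k l where kl: "1 \<le> k" "1 \<le> l" "y = root 3 (real k) *\<^sub>R u k" "z = root 3 (real l) *\<^sub>R u l"
      by blast
    with \<open>y \<noteq> z\<close> have "k < l \<or> l < k" by (metis linorder_neqE_nat)
    then show "\<gamma> / 4 \<le> dist y z"
      using separated[of k l] separated[of l k] kl by (auto simp: dist_commute)
  qed
  show "?S \<noteq> {}" by blast
  obtain K where K: "\<And>y. \<exists>k\<ge>1. dist y (root 3 (real k) *\<^sub>R u k) \<le> K" using relatively_dense by blast
  have "infdist y ?S \<le> K" for y
  proof -
    obtain k where k: "1 \<le> k" "dist y (root 3 (real k) *\<^sub>R u k) \<le> K" using K by blast
    have "infdist y ?S \<le> dist y (root 3 (real k) *\<^sub>R u k)" using k(1) by (intro infdist_le) blast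
    then show ?thesis using k(2) by simp
  qed
  then show "bdd_above (range (\<lambda>y. infdist y ?S))" by (intro bdd_aboveI2) 
qed

end

subsection \<open>Unfolding the tetrahedron\<close>

definition sg :: "int \<Rightarrow> real" where
  "sg i = (if even i then 1 else -1)"

text \<open>A zigzag of period 2, with value 1 at even and -1 at odd integers.\<close>

definition tri :: "real \<Rightarrow> real" where
  "tri x = sg \<lfloor>x\<rfloor> * (1 - 2 * (x - \<lfloor>x\<rfloor>))"

lemma sg_cases: "sg i = 1 \<or> sg i = -1"
  by (simp add: sg_def)

lemma sg_add: "sg (i + j) = sg i * sg j"
  by (auto simp: sg_def)

lemma sg_simps [simp]: "sg 0 = 1" "sg 1 = -1" "sg (i + 1) = - sg i" "sg (1 + i) = - sg i" "sg (2 * i) = 1"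
    "sg i * sg i = 1" "\<bar>sg i\<bar> = 1"
  by (auto simp: sg_def)

text \<open>Both ends are included because the formulas of adjacent cells agree at the common
  integer; one formula then covers a leg together with its end points.\<close>

lemma tri_eq:
  assumes "of_int i \<le> x" "x \<le> of_int i + 1"
  shows "tri x = sg i * (1 - 2 * (x - of_int i))"
proof (cases "x = of_int i + 1")
  case True
  then have "\<lfloor>x\<rfloor> = i + 1" by linarith
  then show ?thesis using True by (simp add: tri_def)
next
  case False
  then have "\<lfloor>x\<rfloor> = i" using assms by linarith
  then show ?thesis by (simp add: tri_def)
qed

lemma tri_of_int: "tri (of_int i) = sg i"
  by (simp add: tri_def)

lemma tri_add_int: "tri (x + of_int m) = sg m * tri x"
  by (simp add: tri_def sg_add)

text \<open>Each cell has slope 2 or -2. For points in different cells, the values at the integers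
  in between change by at most 2 per unit.\<close>

lemma tri_lipschitz: "\<bar>tri x - tri y\<bar> \<le> 2 * \<bar>x - y\<bar>"
proof -
  have cell: "\<bar>tri x - tri y\<bar> \<le> 2 * (y - x)"
    if "of_int i \<le> x" "x \<le> y" "y \<le> of_int i + 1" for i x y
  proof -
    have "tri x - tri y = sg i * (2 * (y - x))"
      using that by (simp add: tri_eq[of i] algebra_simps)
    then show ?thesis using that by (simp add: abs_mult)
  qed
  have le: "\<bar>tri x - tri y\<bar> \<le> 2 * (y - x)" if "x \<le> y" for x y
  proof (cases "\<lfloor>x\<rfloor> = \<lfloor>y\<rfloor>")
    case True
    then show ?thesis by (intro cell[of "\<lfloor>x\<rfloor>"]) (use that in linarith)+
  next
    case False
    define i j where "i = \<lfloor>x\<rfloor> + 1" and "j = \<lfloor>y\<rfloor>"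
    have ij: "i \<le> j" using False floor_mono[OF that] by (simp add: i_def j_def)
    have x: "\<bar>tri x - tri (of_int i)\<bar> \<le> 2 * (of_int i - x)"
      by (intro cell[of "\<lfloor>x\<rfloor>"]) (unfold i_def, linarith+)
    have y: "\<bar>tri (of_int j) - tri y\<bar> \<le> 2 * (y - of_int j)"
      by (intro cell[of "\<lfloor>y\<rfloor>"]) (unfold j_def, linarith+)
    have "\<bar>sg i - sg j\<bar> \<le> 2 * of_int (j - i)"
    proof (cases "i = j")
      case False
      then have "1 \<le> j - i" using ij by simp
      then have "(1::real) \<le> of_int (j - i)" by linarith
      then show ?thesis using sg_cases[of i] sg_cases[of j] by auto
    qed simp
    then show ?thesis using x y by (simp add: tri_of_int)
  qed
  show ?thesis using le[of x y] le[of y x] by (cases "x \<le> y") (auto simp: abs_minus_commute)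
qed

text \<open>The axes \<open>E1\<close>, \<open>E2\<close>, \<open>E3\<close> are the midpoints of three edges; the tetrahedron is inscribed in the
  cube \<open>{pt a b c |a b c. \<bar>a\<bar> \<le> 1 \<and> \<bar>b\<bar> \<le> 1 \<and> \<bar>c\<bar> \<le> 1}\<close>.\<close>

locale tetrahedron =
  fixes E1 E2 E3 :: "real^3"
  assumes inner_axes: "E1 \<bullet> E1 = 1/3" "E2 \<bullet> E2 = 1/3" "E3 \<bullet> E3 = 1/3"
    "E1 \<bullet> E2 = 0" "E1 \<bullet> E3 = 0" "E2 \<bullet> E3 = 0"
begin

definition pt :: "real \<Rightarrow> real \<Rightarrow> real \<Rightarrow> real^3" where
  "pt a b c = a *\<^sub>R E1 + b *\<^sub>R E2 + c *\<^sub>R E3"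

abbreviation A where "A \<equiv> pt 1 (-1) (-1)"
abbreviation B where "B \<equiv> pt 1 1 1"
abbreviation C where "C \<equiv> pt (-1) 1 (-1)"
abbreviation D where "D \<equiv> pt (-1) (-1) 1"
abbreviation V where "V \<equiv> {A, B, C, D}"

lemma inner_pt: "pt a b c \<bullet> pt a' b' c' = (a * a' + b * b' + c * c') / 3"
  using inner_axes
  by (simp add: pt_def inner_add_left inner_add_right inner_commute[of E2 E1] inner_commute[of E3 E1]
      inner_commute[of E3 E2] field_simps)

lemma pt_add: "pt a b c + pt a' b' c' = pt (a + a') (b + b') (c + c')"
  and pt_diff: "pt a b c - pt a' b' c' = pt (a - a') (b - b') (c - c')"
  and pt_scaleR: "x *\<^sub>R pt a b c = pt (x * a) (x * b) (x * c)"
  and pt_uminus: "- pt a b c = pt (- a) (- b) (- c)"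
  by (simp_all add: pt_def algebra_simps)

lemmas pt_simps = pt_add pt_diff pt_scaleR pt_uminus inner_pt

lemma pt_inject: "pt a b c = pt a' b' c' \<longleftrightarrow> a = a' \<and> b = b' \<and> c = c'"
proof
  assume "pt a b c = pt a' b' c'"
  then have "(pt a b c - pt a' b' c') \<bullet> (pt a b c - pt a' b' c') = 0" by simp
  then have "(a - a')\<^sup>2 + (b - b')\<^sup>2 + (c - c')\<^sup>2 = 0"
    by (simp add: pt_simps power2_eq_square)
  then show "a = a' \<and> b = b' \<and> c = c'"
    by (smt (verit) zero_le_power2 power2_eq_iff_nonneg zero_eq_power2 diff_eq_diff_eq)
qed simp

lemma pt_surj: obtains a b c where "p = pt a b c"
proof -
  let ?B = "{pt 1 0 0, pt 0 1 0, pt 0 0 1}"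
  have card: "card ?B = 3" by (simp add: pt_inject)
  have "pairwise orthogonal ?B"
    by (auto simp: pairwise_def orthogonal_def inner_pt)
  moreover have "0 \<notin> ?B"
  proof -
    have "pt 0 0 0 = 0" by (simp add: pt_def)
    then show ?thesis by (metis insert_iff empty_iff pt_inject zero_neq_one)
  qed
  ultimately have "independent ?B"
    by (intro pairwise_orthogonal_independent) auto
  then have "UNIV \<subseteq> span ?B"
    by (intro card_ge_dim_independent) (simp_all add: card)
  then have "p \<in> span ?B" by blast
  then obtain x y z where "p = x *\<^sub>R pt 1 0 0 + y *\<^sub>R pt 0 1 0 + z *\<^sub>R pt 0 0 1"
    by (auto simp: span_insert span_breakdown_eq algebra_simps)
  then have "p = pt x y z" by (simp add: pt_simps)
  then show ?thesis by (rule that)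
qed

text \<open>The vertices are the sign triples with product 1, a set stable under flipping two signs.
  Naming them relative to \<open>s\<close> and \<open>s'\<close> treats one crossing for all
  parities of the cell at once.\<close>

lemma V_eq:
  assumes "s = 1 \<or> s = -1" "s' = 1 \<or> s' = -1"
  shows "V = {pt s s' (s * s'), pt (-s) (-s') (s * s'), pt (-s) s' (- (s * s')), pt s (-s') (- (s * s'))}"
  using assms by (elim disjE; simp; blast)

text \<open>The four unit vectors sum to 0 and satisfy \<open>(\<Sum>u\<in>V. (u \<bullet> p)
  *\<^sub>R u) = (4/3) *\<^sub>R p\<close>, so barycentric coordinates are affine functions of inner
  products.\<close>

lemma barycentric: "p = (\<Sum>u\<in>V. ((1 + 3 * (u \<bullet> p)) / 4) *\<^sub>R u)" "(\<Sum>u\<in>V. (1 + 3 * (u \<bullet> p)) / 4) = 1"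
proof -
  obtain a b c where p: "p = pt a b c" by (rule pt_surj)
  show "p = (\<Sum>u\<in>V. ((1 + 3 * (u \<bullet> p)) / 4) *\<^sub>R u)" "(\<Sum>u\<in>V. (1 + 3 * (u \<bullet> p)) / 4) = 1"
    unfolding p by (simp_all add: pt_simps pt_inject field_simps)
qed

lemma inner_V: "u \<in> V \<Longrightarrow> u' \<in> V \<Longrightarrow> u \<bullet> u' = (if u = u' then 1 else -1/3)"
  by (auto simp: inner_pt pt_inject)

text \<open>The barycentric coordinate at \<open>u\<close> vanishes exactly when
  \<open>u \<bullet> p = -1/3\<close>. A singleton \<open>S\<close> gives a face, a pair an
  edge.\<close>

lemma hull_iff:
  assumes "S \<subseteq> V"
  shows "p \<in> convex hull (V - S) \<longleftrightarrow> (\<forall>u\<in>S. u \<bullet> p = -1/3) \<and> (\<forall>u\<in>V. u \<bullet> p \<ge> -1/3)"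
proof
  let ?K = "(\<Inter>u\<in>S. {p. u \<bullet> p = -1/3}) \<inter> (\<Inter>u\<in>V. {p. u \<bullet> p \<ge> -1/3})"
  have "convex ?K"
    by (intro convex_Int convex_INT convex_hyperplane convex_halfspace_ge)
  moreover have "V - S \<subseteq> ?K"
  proof
    fix x assume x: "x \<in> V - S"
    have "u \<bullet> x = -1/3" if "u \<in> S" for u
    proof -
      have "u \<in> V" "x \<in> V" "u \<noteq> x" using that x assms by blast+
      then show ?thesis using inner_V[of u x] by simp
    qed
    moreover have "u \<bullet> x \<ge> -1/3" if "u \<in> V" for u
      using inner_V[of u x] that x by auto
    ultimately show "x \<in> ?K" by blast
  qed
  ultimately have sub: "convex hull (V - S) \<subseteq> ?K" by (rule hull_minimal[rotated])
  assume "p \<in> convex hull (V - S)"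
  then have "p \<in> ?K" using sub by blast
  then show "(\<forall>u\<in>S. u \<bullet> p = -1/3) \<and> (\<forall>u\<in>V. u \<bullet> p \<ge> -1/3)" by blast
next
  assume p: "(\<forall>u\<in>S. u \<bullet> p = -1/3) \<and> (\<forall>u\<in>V. u \<bullet> p \<ge> -1/3)"
  let ?c = "\<lambda>u. (1 + 3 * (u \<bullet> p)) / 4"
  have fin: "finite V" by simp
  have "(\<Sum>u\<in>V - S. ?c u) = (\<Sum>u\<in>V. ?c u)"
    using p fin by (intro sum.mono_neutral_left) auto
  then have 1: "(\<Sum>u\<in>V - S. ?c u) = 1" using barycentric(2) by simp
  have "(\<Sum>u\<in>V - S. ?c u *\<^sub>R u) = (\<Sum>u\<in>V. ?c u *\<^sub>R u)"
    using p fin by (intro sum.mono_neutral_left) auto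
  also have "\<dots> = p" by (rule barycentric(1)[symmetric])
  finally have 2: "(\<Sum>u\<in>V - S. ?c u *\<^sub>R u) = p" .
  have 3: "\<forall>u\<in>V - S. 0 \<le> ?c u"
  proof
    fix u assume "u \<in> V - S"
    then have "u \<bullet> p \<ge> -1/3" using p by blast
    then show "0 \<le> ?c u" by simp
  qed
  show "p \<in> convex hull (V - S)"
    unfolding convex_hull_finite[OF finite_Diff[OF fin]] using 1 2 3
    by (intro CollectI exI[of _ ?c]) simp
qed

text \<open>The equality of inner products makes \<open>x\<close> equidistant from \<open>P\<close>
  and \<open>Q\<close>, so its foot on their line is the midpoint.\<close>

lemma closest_point_edge:
  fixes P Q x :: "real^3"
  assumes "P \<bullet> P = 1" "Q \<bullet> Q = 1" "x \<bullet> P = x \<bullet> Q"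
  shows "closest_point (affine hull {P, Q}) x = (1/2) *\<^sub>R (P + Q)"
proof -
  let ?L = "affine hull {P, Q}" and ?m = "(1/2) *\<^sub>R (P + Q)"
  have "dist x ?m \<le> dist x y" if yL: "y \<in> ?L" for y
  proof -
    obtain a b where y: "y = a *\<^sub>R P + b *\<^sub>R Q" "a + b = 1"
      using yL unfolding affine_hull_2 by blast
    have b: "b = 1 - a" using y by simp
    have "y - ?m = (a - 1/2) *\<^sub>R (P - Q)"
      unfolding y(1) b by (simp add: algebra_simps flip: scaleR_add_left)
    then have "(x - ?m) \<bullet> (y - ?m) = 0"
      using assms by (simp add: inner_simps inner_commute[of Q P])
    then have "(dist x y)\<^sup>2 = (dist x ?m)\<^sup>2 + (dist y ?m)\<^sup>2"
      using norm_add_Pythagorean[of "x - ?m" "?m - y"]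
      by (simp add: orthogonal_def dist_norm inner_diff_right norm_minus_commute)
    then have "(dist x ?m)\<^sup>2 \<le> (dist x y)\<^sup>2" by simp
    then show ?thesis by (rule power2_le_imp_le) simp
  qed
  moreover have "?m \<in> ?L"
    unfolding affine_hull_2 by (auto intro!: exI[of _ "1/2::real"] simp: algebra_simps)
  ultimately have "?m = closest_point ?L x"
    by (metis closest_point_unique affine_imp_convex affine_affine_hull closed_affine_hull)
  then show ?thesis ..
qed

text \<open>On directions parallel to the current face, folding agrees with the reflection in the plane
  orthogonal to \<open>w + z\<close>.\<close>

lemma fold_direction_eq:
  assumes "w \<in> V" "z \<in> V" "w \<noteq> z" "v \<bullet> w = 0"
  shows "fold_direction V w z v = v - (3/2 * (v \<bullet> z)) *\<^sub>R (w + z)"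
proof -
  have dist: "A \<noteq> B" "A \<noteq> C" "A \<noteq> D" "B \<noteq> C" "B \<noteq> D" "C \<noteq> D"
    by (simp_all add: pt_inject)
  obtain P Q where PQ: "V - {w, z} = {P, Q}" "P \<in> V - {w, z}" "Q \<in> V - {w, z}" "P \<noteq> Q"
  proof -
    have "card (V - {w, z}) = 2"
      using assms dist by (subst card_Diff_subset) auto
    then show ?thesis using that by (auto simp: card_2_iff)
  qed
  have "V = {w, z, P, Q}" using PQ(1) assms by blast
  moreover have "\<Sum>{w, z, P, Q} = w + z + P + Q"
  proof -
    have "w \<notin> {z, P, Q}" "z \<notin> {P, Q}" using PQ assms(3) by blast+
    then show ?thesis using PQ(4) by (simp add: add.assoc)
  qed
  moreover have "\<Sum>V = A + B + C + D" using dist by (simp add: add.assoc)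
  ultimately have "A + B + C + D = w + z + P + Q" by metis
  \<comment> \<open>The vertices sum to 0, so the midpoint of the shared edge is expressed through
    the two opposite vertices.\<close>
  then have sum: "P + Q = - (w + z)"
    by (simp add: pt_add algebra_simps eq_neg_iff_add_eq_0 pt_def)
  have mid: "closest_point (affine hull (V - {w, z})) x = - (1/2) *\<^sub>R (w + z)" if "x = w \<or> x = z" for x
  proof -
    have "closest_point (affine hull {P, Q}) x = (1/2) *\<^sub>R (P + Q)"
    proof (rule closest_point_edge)
      show "P \<bullet> P = 1" "Q \<bullet> Q = 1" using PQ inner_V[of P P] inner_V[of Q Q] by auto
      have "x \<in> V" "P \<in> V" "Q \<in> V" "x \<noteq> P" "x \<noteq> Q" using that PQ assms by auto
      then show "x \<bullet> P = x \<bullet> Q" using inner_V[of x P] inner_V[of x Q] by metis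
    qed
    then show ?thesis unfolding PQ(1) sum by (simp flip: scaleR_minus_right)
  qed
  have wz: "w \<bullet> w = 1" "z \<bullet> z = 1" "w \<bullet> z = -1/3" "z \<bullet> w = -1/3"
    using inner_V[of w w] inner_V[of z z] inner_V[of w z] inner_V[of z w] assms by auto
  define n n' where "n = sgn (- (1/2) *\<^sub>R (w + z) - z)" and "n' = sgn (w - (- (1/2) *\<^sub>R (w + z)))"
  \<comment> \<open>\<open>w + 3 *\<^sub>R z\<close> is orthogonal to \<open>w\<close>, hence
    parallel to the current face; likewise \<open>3 *\<^sub>R w + z\<close> is orthogonal to
    \<open>z\<close>.\<close>
  have n: "n = (- 1 / (2 * sqrt 2)) *\<^sub>R (w + 3 *\<^sub>R z)"
  proof -
    have eq: "- (1/2) *\<^sub>R (w + z) - z = (- 1/2) *\<^sub>R (w + 3 *\<^sub>R z)"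
      by (simp add: vec_eq_iff field_simps)
    have "norm (w + 3 *\<^sub>R z) = sqrt 8"
      by (simp add: norm_eq_sqrt_inner inner_simps wz)
    also have "\<dots> = 2 * sqrt 2" using real_sqrt_mult[of 4 2] by simp
    finally show ?thesis unfolding n_def eq sgn_scaleR by (simp add: sgn_div_norm field_simps)
  qed
  have n': "n' = (1 / (2 * sqrt 2)) *\<^sub>R (3 *\<^sub>R w + z)"
  proof -
    have eq: "w - (- (1/2) *\<^sub>R (w + z)) = (1/2) *\<^sub>R (3 *\<^sub>R w + z)"
      by (simp add: vec_eq_iff field_simps)
    have "norm (3 *\<^sub>R w + z) = sqrt 8"
      by (simp add: norm_eq_sqrt_inner inner_simps wz)
    also have "\<dots> = 2 * sqrt 2" using real_sqrt_mult[of 4 2] by simp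
    finally show ?thesis unfolding n'_def eq sgn_scaleR by (simp add: sgn_div_norm field_simps)
  qed
  have "fold_direction V w z v = v - (v \<bullet> n) *\<^sub>R n + (v \<bullet> n) *\<^sub>R n'"
    unfolding fold_direction_def Let_def mid[OF disjI1[OF refl]] mid[OF disjI2[OF refl]] n_def n'_def by simp
  also have "\<dots> = v + (v \<bullet> n) *\<^sub>R (n' - n)"
    by (simp add: algebra_simps)
  also have "n' - n = (4 / (2 * sqrt 2)) *\<^sub>R (w + z)"
    by (simp add: n n' vec_eq_iff field_simps)
  also have "v \<bullet> n = - 3 / (2 * sqrt 2) * (v \<bullet> z)"
    by (simp add: n inner_simps assms)
  finally show ?thesis by (simp add: algebra_simps)
qed

text \<open>The velocity is parallel to the face, and the barycentric coordinate at \<open>z\<close>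
  decreases along it and vanishes at \<open>q\<close>, so the leg ends there. The other two are
  strictly positive at \<open>q\<close>: the exit point is no vertex, and the \<open>THE\<close> in
  \<open>next_leg\<close> picks \<open>z\<close>.\<close>

lemma next_leg_eq:
  fixes w z p q v :: "real^3" and T d :: real
  defines "l \<equiv> \<lparr>omitted = w, start_time = T, start_point = p, velocity = v\<rparr>"
    and "q \<equiv> p + d *\<^sub>R v"
  assumes "w \<in> V" "z \<in> V" "w \<noteq> z" "0 \<le> d" "v \<bullet> w = 0" "v \<bullet> z < 0"
    and "w \<bullet> q = -1/3" "z \<bullet> q = -1/3"
    and "\<And>u. u \<in> V - {w, z} \<Longrightarrow> u \<bullet> q > -1/3"
  shows "end_time V l = T + d"
    and "next_leg V l = \<lparr>omitted = z, start_time = T + d, start_point = q,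
           velocity = v - (3/2 * (v \<bullet> z)) *\<^sub>R (w + z)\<rparr>"
proof -
  have q: "\<forall>u\<in>V. u \<bullet> q \<ge> -1/3"
  proof
    fix u assume "u \<in> V"
    then consider "u = w" | "u = z" | "u \<in> V - {w, z}" by blast
    then show "u \<bullet> q \<ge> -1/3"
    proof cases
      case 1 then show ?thesis using assms(9) by simp
    next
      case 2 then show ?thesis using assms(10) by simp
    next
      case 3 then show ?thesis by (rule assms(11)[THEN less_imp_le])
    qed
  qed
  have dur: "leg_duration V l = d"
    unfolding leg_duration_def
  proof (rule cSup_eq_maximum)
    show "d \<in> {\<tau>. 0 \<le> \<tau> \<and> start_point l + \<tau> *\<^sub>R velocity l \<in> convex hull (V - {omitted l})}"
    proof -
      have "q \<in> convex hull (V - {w})"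
        using hull_iff[of "{w}" q] q assms(3,9) by blast
      then show ?thesis using assms(6) by (simp add: l_def q_def)
    qed
  next
    fix \<tau> assume "\<tau> \<in> {\<tau>. 0 \<le> \<tau> \<and> start_point l + \<tau> *\<^sub>R velocity l \<in> convex hull (V - {omitted l})}"
    then have "p + \<tau> *\<^sub>R v \<in> convex hull (V - {w})" by (simp add: l_def)
    then have "\<forall>u\<in>V. u \<bullet> (p + \<tau> *\<^sub>R v) \<ge> -1/3" using assms(3) by (subst (asm) hull_iff) blast+
    then have "z \<bullet> (p + \<tau> *\<^sub>R v) \<ge> -1/3" using assms(4) by (rule bspec)
    then have "z \<bullet> (p + \<tau> *\<^sub>R v) \<ge> z \<bullet> q" using assms by simp
    then have "(\<tau> - d) * (v \<bullet> z) \<ge> 0"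
      by (simp add: q_def inner_simps inner_commute algebra_simps)
    then show "\<tau> \<le> d" using assms(8) by (simp add: zero_le_mult_iff)
  qed
  then show "end_time V l = T + d" by (simp add: end_time_def l_def)
  have "(THE z'. z' \<in> V - {w} \<and> q \<in> convex hull (V - {w, z'})) = z"
  proof (rule the_equality)
    show "z \<in> V - {w} \<and> q \<in> convex hull (V - {w, z})"
      using assms(3-5,9,10) q hull_iff[of "{w, z}" q] by blast
  next
    fix z' assume z': "z' \<in> V - {w} \<and> q \<in> convex hull (V - {w, z'})"
    then have "z' \<bullet> q = -1/3" using assms(3) hull_iff[of "{w, z'}" q] by blast
    then show "z' = z" using z' assms(11)[of z'] by (metis Diff_iff insert_iff singletonD order_less_irrefl)
  qed
  then show "next_leg V l = \<lparr>omitted = z, start_time = T + d, start_point = q,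
           velocity = v - (3/2 * (v \<bullet> z)) *\<^sub>R (w + z)\<rparr>"
    using fold_direction_eq[OF assms(3,4,5,7)] dur
    by (simp add: next_leg_def end_point_def end_time_def l_def q_def Let_def)
qed

text \<open>The folding of the plane onto the surface; \<open>(x, y)\<close> stands for the point \<open>B + x (C - B) + y (A - B)\<close>
  of the plane of the face \<open>ABC\<close>.\<close>

definition dev :: "real \<Rightarrow> real \<Rightarrow> real^3" where
  "dev x y = pt (tri x) (tri y) (tri (x + y))"

end

section \<open>Legs of the flow as triangles of the unfolded plane\<close>

locale tetrahedron_flow = tetrahedron +
  fixes \<alpha> :: "real^2"
  assumes pos: "\<alpha> $ 1 > 0" "\<alpha> $ 2 > 0"
    and irrational: "\<And>t. t > 0 \<Longrightarrow> t * \<alpha> $ 1 \<in> \<int> \<Longrightarrow> t * \<alpha> $ 2 \<notin> \<int>"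
begin

abbreviation path :: "real \<Rightarrow> real^3" where
  "path t \<equiv> dev (t * \<alpha> $ 1) (t * \<alpha> $ 2)"

text \<open>The leg that starts at time \<open>T\<close>, where \<open>i\<close>, \<open>j\<close>, \<open>k\<close> are the integer parts of the unfolded
  coordinates \<open>x\<close>, \<open>y\<close>, \<open>x + y\<close> at that time.\<close>

definition leg_of :: "real \<Rightarrow> int \<Rightarrow> int \<Rightarrow> int \<Rightarrow> leg" where
  "leg_of T i j k =
     \<lparr>omitted = pt (- (sg j * sg k)) (- (sg i * sg k)) (sg i * sg j), start_time = T, start_point = path T,
      velocity = pt (-2 * \<alpha> $ 1 * sg i) (-2 * \<alpha> $ 2 * sg j) (-2 * (\<alpha> $ 1 + \<alpha> $ 2) * sg k)\<rparr>"

definition in_cell :: "real \<Rightarrow> int \<Rightarrow> int \<Rightarrow> int \<Rightarrow> bool" where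
  "in_cell t i j k \<longleftrightarrow> i \<le> t * \<alpha> $ 1 \<and> t * \<alpha> $ 1 \<le> i + 1 \<and> j \<le> t * \<alpha> $ 2 \<and> t * \<alpha> $ 2 \<le> j + 1 \<and>
     k \<le> t * (\<alpha> $ 1 + \<alpha> $ 2) \<and> t * (\<alpha> $ 1 + \<alpha> $ 2) \<le> k + 1"

lemma path_in_cell:
  assumes "in_cell t i j k"
  shows "path t = pt (sg i * (1 - 2 * (t * \<alpha> $ 1 - i))) (sg j * (1 - 2 * (t * \<alpha> $ 2 - j)))
     (sg k * (1 - 2 * (t * (\<alpha> $ 1 + \<alpha> $ 2) - k)))"
  using assms tri_eq[of i "t * \<alpha> $ 1"] tri_eq[of j "t * \<alpha> $ 2"] tri_eq[of k "t * (\<alpha> $ 1 + \<alpha> $ 2)"]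
  by (simp add: in_cell_def dev_def distrib_left)

lemma path_along_leg:
  assumes "in_cell T i j k" "in_cell t i j k"
  shows "path t = path T + (t - T) *\<^sub>R velocity (leg_of T i j k)"
  unfolding path_in_cell[OF assms(1)] path_in_cell[OF assms(2)]
  by (simp add: leg_of_def pt_simps pt_inject algebra_simps)

lemma in_cell_mono:
  assumes "in_cell T i j k" "in_cell T' i j k" "T \<le> t" "t \<le> T'"
  shows "in_cell t i j k"
proof -
  have "T * c \<le> t * c" "t * c \<le> T' * c" if "c > 0" for c
    using that assms by simp_all
  from this[of "\<alpha> $ 1"] this[of "\<alpha> $ 2"] this[of "\<alpha> $ 1 + \<alpha> $ 2"] show ?thesis
    using pos assms(1,2) unfolding in_cell_def by linarith
qed

text \<open>Half-open because \<open>x\<close>, \<open>y\<close> and \<open>x + y\<close> all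
  increase: at a crossing time the point still belongs to the closed old cell, but strictly only to
  the new one.\<close>

definition strictly_in_cell :: "real \<Rightarrow> int \<Rightarrow> int \<Rightarrow> int \<Rightarrow> bool" where
  "strictly_in_cell t i j k \<longleftrightarrow> in_cell t i j k \<and> t * \<alpha> $ 1 < i + 1 \<and> t * \<alpha> $ 2 < j + 1 \<and> t * (\<alpha> $ 1 + \<alpha> $ 2) < k + 1"

text \<open>For \<open>k = i + j\<close> the cell is the triangle with right angle at
  \<open>(i, j)\<close>. The ray moves away from both legs of that angle and can leave only through
  the hypotenuse \<open>x + y = i + j + 1\<close>.\<close>

lemma crossing_up:
  assumes T: "strictly_in_cell T i j (i + j)"
  obtains T' where "T < T'" "in_cell T' i j (i + j)" "strictly_in_cell T' i j (i + j + 1)"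
    "end_time V (leg_of T i j (i + j)) = T'" "next_leg V (leg_of T i j (i + j)) = leg_of T' i j (i + j + 1)"
proof -
  let ?a = "\<alpha> $ 1" and ?b = "\<alpha> $ 2"
  have T1: "i \<le> T * ?a" "T * ?a < i + 1" "j \<le> T * ?b" "T * ?b < j + 1"
    "i + j \<le> T * ?a + T * ?b" "T * ?a + T * ?b < i + j + 1"
    using T unfolding strictly_in_cell_def in_cell_def by (auto simp: distrib_left)
  have cell: "in_cell T i j (i + j)" using T by (simp add: strictly_in_cell_def)
  define s s' where "s = sg i" and "s' = sg j"
  have ss: "s = 1 \<or> s = -1" "s' = 1 \<or> s' = -1" using sg_cases by (auto simp: s_def s'_def)
  define T' where "T' = (i + j + 1) / (?a + ?b)"
  have sum: "T' * (?a + ?b) = i + j + 1"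
    using pos by (simp add: T'_def)
  then have T'_eq: "T' * ?a + T' * ?b = i + j + 1"
    by (simp add: distrib_left)
  have "T * (?a + ?b) < T' * (?a + ?b)" using T1 T'_eq by (simp add: distrib_left)
  then have less: "T < T'" using pos by (simp add: mult_less_cancel_right)
  then have m: "T * ?a < T' * ?a" "T * ?b < T' * ?b" using pos by simp_all
  have cell': "in_cell T' i j (i + j)" and new: "strictly_in_cell T' i j (i + j + 1)"
    using T1 T'_eq m unfolding strictly_in_cell_def in_cell_def distrib_left by auto
  let ?w = "pt (-s) (-s') (s * s')" and ?z = "pt s s' (s * s')"
  let ?v = "pt (-2 * ?a * s) (-2 * ?b * s') (-2 * (?a + ?b) * (s * s'))"
  have leg: "leg_of T i j (i + j) = \<lparr>omitted = ?w, start_time = T, start_point = path T, velocity = ?v\<rparr>"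
    unfolding leg_of_def sg_add s_def[symmetric] s'_def[symmetric] using ss by (auto simp: algebra_simps)
  have q: "path T + (T' - T) *\<^sub>R ?v = path T'"
    using path_along_leg[OF cell cell'] by (simp add: leg)
  \<comment> \<open>Position on the crossed edge. It is interior because both coordinates have
    strictly increased since time \<open>T\<close>.\<close>
  define \<xi> where "\<xi> = T' * ?a - i"
  have \<xi>: "0 < \<xi>" "\<xi> < 1" using T1 m T'_eq unfolding \<xi>_def by linarith+
  have b: "T' * ?b - j = 1 - \<xi>" using T'_eq by (simp add: \<xi>_def)
  have pT': "path T' = pt (s * (1 - 2 * \<xi>)) (s' * (2 * \<xi> - 1)) (- (s * s'))"
    unfolding path_in_cell[OF cell'] sum \<xi>_def[symmetric] b sg_add s_def[symmetric] s'_def[symmetric]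
    by simp
  have wz: "?w \<in> V" "?z \<in> V" "?w \<noteq> ?z" "0 \<le> T' - T" "?v \<bullet> ?w = 0" "?v \<bullet> ?z < 0"
      "?w \<bullet> path T' = -1/3" "?z \<bullet> path T' = -1/3"
    unfolding pT' using V_eq[OF ss] less pos ss by (auto simp: inner_pt pt_inject algebra_simps)
  have u: "u \<bullet> path T' > -1/3" if "u \<in> V - {?w, ?z}" for u
  proof -
    have "u = pt (-s) s' (- (s * s')) \<or> u = pt s (-s') (- (s * s'))"
      using that V_eq[OF ss] by auto
    then show ?thesis unfolding pT' using ss \<xi> by (auto simp: inner_pt algebra_simps)
  qed
  have vel: "?v - (3/2 * (?v \<bullet> ?z)) *\<^sub>R (?w + ?z) = pt (-2 * ?a * s) (-2 * ?b * s') (2 * (?a + ?b) * (s * s'))"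
    unfolding pt_simps pt_inject using ss by (elim disjE; simp; simp add: field_simps)
  note nl = next_leg_eq[of ?w ?z "T' - T" ?v "path T" T, unfolded q, OF wz u, folded leg]
  show ?thesis
  proof (rule that[OF less cell' new])
    show "end_time V (leg_of T i j (i + j)) = T'" using nl(1) by simp
    have "next_leg V (leg_of T i j (i + j)) = \<lparr>omitted = ?z, start_time = T', start_point = path T', velocity = pt (-2 * ?a * s) (-2 * ?b * s') (2 * (?a + ?b) * (s * s'))\<rparr>"
      using nl(2) unfolding vel leg by simp
    also have "\<dots> = leg_of T' i j (i + j + 1)"
      unfolding leg_of_def sg_simps sg_add s_def[symmetric] s'_def[symmetric]
      using ss by (auto simp: algebra_simps)
    finally show "next_leg V (leg_of T i j (i + j)) = leg_of T' i j (i + j + 1)" .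
  qed
qed

text \<open>For \<open>k = i + j + 1\<close> the right angle is at \<open>(i + 1, j + 1)\<close> and
  two exits are possible. The assumption compares the times at which the lines
  \<open>x = i + 1\<close> and \<open>y = j + 1\<close> are reached.\<close>

lemma crossing_down_1:
  assumes T: "strictly_in_cell T i j (i + j + 1)" and first: "(i + 1) / \<alpha> $ 1 < (j + 1) / \<alpha> $ 2"
  obtains T' where "T < T'" "in_cell T' i j (i + j + 1)" "strictly_in_cell T' (i + 1) j (i + j + 1)"
    "end_time V (leg_of T i j (i + j + 1)) = T'"
    "next_leg V (leg_of T i j (i + j + 1)) = leg_of T' (i + 1) j (i + j + 1)"
proof -
  let ?a = "\<alpha> $ 1" and ?b = "\<alpha> $ 2"
  have T1: "i \<le> T * ?a" "T * ?a < i + 1" "j \<le> T * ?b" "T * ?b < j + 1"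
    "i + j + 1 \<le> T * ?a + T * ?b" "T * ?a + T * ?b < i + j + 2"
    using T unfolding strictly_in_cell_def in_cell_def by (auto simp: distrib_left)
  have cell: "in_cell T i j (i + j + 1)" using T by (simp add: strictly_in_cell_def)
  define s s' where "s = sg i" and "s' = sg j"
  have ss: "s = 1 \<or> s = -1" "s' = 1 \<or> s' = -1" using sg_cases by (auto simp: s_def s'_def)
  define T' where "T' = (i + 1) / ?a"
  have T'_eq: "T' * ?a = i + 1" using pos by (simp add: T'_def)
  have b1: "T' * ?b < j + 1" using first pos by (simp add: T'_def field_simps)
  have less: "T < T'" using T1(2) pos by (simp add: T'_def field_simps)
  then have m: "T * ?a < T' * ?a" "T * ?b < T' * ?b" using pos by simp_all
  have cell': "in_cell T' i j (i + j + 1)" and new: "strictly_in_cell T' (i + 1) j (i + j + 1)"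
    using T1 T'_eq b1 m unfolding strictly_in_cell_def in_cell_def distrib_left by auto
  let ?w = "pt s s' (s * s')" and ?z = "pt s (-s') (- (s * s'))"
  let ?v = "pt (-2 * ?a * s) (-2 * ?b * s') (2 * (?a + ?b) * (s * s'))"
  have leg: "leg_of T i j (i + j + 1) = \<lparr>omitted = ?w, start_time = T, start_point = path T, velocity = ?v\<rparr>"
    unfolding leg_of_def sg_simps sg_add s_def[symmetric] s'_def[symmetric] using ss by (auto simp: algebra_simps)
  have q: "path T + (T' - T) *\<^sub>R ?v = path T'"
    using path_along_leg[OF cell cell'] by (simp add: leg)
  define \<eta> where "\<eta> = T' * ?b - j"
  have \<eta>: "0 < \<eta>" "\<eta> < 1" using T1 m b1 unfolding \<eta>_def by linarith+
  have ab: "T' * ?a - i = 1" "T' * (?a + ?b) - (i + j + 1) = \<eta>"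
    using T'_eq by (simp_all add: \<eta>_def distrib_left)
  have pT': "path T' = pt (-s) (s' * (1 - 2 * \<eta>)) (- (s * s' * (1 - 2 * \<eta>)))"
    unfolding path_in_cell[OF cell'] of_int_add of_int_1 ab \<eta>_def[symmetric] sg_simps sg_add s_def[symmetric] s'_def[symmetric]
    using ab by simp
  have wz: "?w \<in> V" "?z \<in> V" "?w \<noteq> ?z" "0 \<le> T' - T" "?v \<bullet> ?w = 0" "?v \<bullet> ?z < 0"
      "?w \<bullet> path T' = -1/3" "?z \<bullet> path T' = -1/3"
    unfolding pT' using V_eq[OF ss] less pos ss by (auto simp: inner_pt pt_inject algebra_simps)
  have u: "u \<bullet> path T' > -1/3" if "u \<in> V - {?w, ?z}" for u
  proof -
    have "u = pt (-s) s' (- (s * s')) \<or> u = pt (-s) (-s') (s * s')"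
      using that V_eq[OF ss] by auto
    then show ?thesis unfolding pT' using ss \<eta> by (auto simp: inner_pt algebra_simps)
  qed
  have vel: "?v - (3/2 * (?v \<bullet> ?z)) *\<^sub>R (?w + ?z) = pt (2 * ?a * s) (-2 * ?b * s') (2 * (?a + ?b) * (s * s'))"
    unfolding pt_simps pt_inject using ss by (elim disjE; simp; simp add: field_simps)
  note nl = next_leg_eq[of ?w ?z "T' - T" ?v "path T" T, unfolded q, OF wz u, folded leg]
  show ?thesis
  proof (rule that[OF less cell' new])
    show "end_time V (leg_of T i j (i + j + 1)) = T'" using nl(1) by simp
    have "next_leg V (leg_of T i j (i + j + 1)) = \<lparr>omitted = ?z, start_time = T', start_point = path T', velocity = pt (2 * ?a * s) (-2 * ?b * s') (2 * (?a + ?b) * (s * s'))\<rparr>"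
      using nl(2) unfolding vel leg by simp
    also have "\<dots> = leg_of T' (i + 1) j (i + j + 1)"
      unfolding leg_of_def sg_simps sg_add s_def[symmetric] s'_def[symmetric]
      using ss by (auto simp: algebra_simps)
    finally show "next_leg V (leg_of T i j (i + j + 1)) = leg_of T' (i + 1) j (i + j + 1)" .
  qed
qed

text \<open>Mirror image of the preceding case, with the two coordinates exchanged.\<close>

lemma crossing_down_2:
  assumes T: "strictly_in_cell T i j (i + j + 1)" and first: "(j + 1) / \<alpha> $ 2 < (i + 1) / \<alpha> $ 1"
  obtains T' where "T < T'" "in_cell T' i j (i + j + 1)" "strictly_in_cell T' i (j + 1) (i + j + 1)"
    "end_time V (leg_of T i j (i + j + 1)) = T'"
    "next_leg V (leg_of T i j (i + j + 1)) = leg_of T' i (j + 1) (i + j + 1)"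
proof -
  let ?a = "\<alpha> $ 1" and ?b = "\<alpha> $ 2"
  have T1: "i \<le> T * ?a" "T * ?a < i + 1" "j \<le> T * ?b" "T * ?b < j + 1"
    "i + j + 1 \<le> T * ?a + T * ?b" "T * ?a + T * ?b < i + j + 2"
    using T unfolding strictly_in_cell_def in_cell_def by (auto simp: distrib_left)
  have cell: "in_cell T i j (i + j + 1)" using T by (simp add: strictly_in_cell_def)
  define s s' where "s = sg i" and "s' = sg j"
  have ss: "s = 1 \<or> s = -1" "s' = 1 \<or> s' = -1" using sg_cases by (auto simp: s_def s'_def)
  define T' where "T' = (j + 1) / ?b"
  have T'_eq: "T' * ?b = j + 1" using pos by (simp add: T'_def)
  have a1: "T' * ?a < i + 1" using first pos by (simp add: T'_def field_simps)
  have less: "T < T'" using T1(4) pos by (simp add: T'_def field_simps)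
  then have m: "T * ?a < T' * ?a" "T * ?b < T' * ?b" using pos by simp_all
  have cell': "in_cell T' i j (i + j + 1)" and new: "strictly_in_cell T' i (j + 1) (i + j + 1)"
    using T1 T'_eq a1 m unfolding strictly_in_cell_def in_cell_def distrib_left by auto
  let ?w = "pt s s' (s * s')" and ?z = "pt (-s) s' (- (s * s'))"
  let ?v = "pt (-2 * ?a * s) (-2 * ?b * s') (2 * (?a + ?b) * (s * s'))"
  have leg: "leg_of T i j (i + j + 1) = \<lparr>omitted = ?w, start_time = T, start_point = path T, velocity = ?v\<rparr>"
    unfolding leg_of_def sg_simps sg_add s_def[symmetric] s'_def[symmetric] using ss by (auto simp: algebra_simps)
  have q: "path T + (T' - T) *\<^sub>R ?v = path T'"
    using path_along_leg[OF cell cell'] by (simp add: leg)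
  define \<xi> where "\<xi> = T' * ?a - i"
  have \<xi>: "0 < \<xi>" "\<xi> < 1" using T1 m a1 unfolding \<xi>_def by linarith+
  have ab: "T' * ?b - j = 1" "T' * (?a + ?b) - (i + j + 1) = \<xi>"
    using T'_eq by (simp_all add: \<xi>_def distrib_left)
  have pT': "path T' = pt (s * (1 - 2 * \<xi>)) (-s') (- (s * s' * (1 - 2 * \<xi>)))"
    unfolding path_in_cell[OF cell'] of_int_add of_int_1 ab \<xi>_def[symmetric] sg_simps sg_add s_def[symmetric] s'_def[symmetric]
    using ab by simp
  have wz: "?w \<in> V" "?z \<in> V" "?w \<noteq> ?z" "0 \<le> T' - T" "?v \<bullet> ?w = 0" "?v \<bullet> ?z < 0"
      "?w \<bullet> path T' = -1/3" "?z \<bullet> path T' = -1/3"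
    unfolding pT' using V_eq[OF ss] less pos ss by (auto simp: inner_pt pt_inject algebra_simps)
  have u: "u \<bullet> path T' > -1/3" if "u \<in> V - {?w, ?z}" for u
  proof -
    have "u = pt s (-s') (- (s * s')) \<or> u = pt (-s) (-s') (s * s')"
      using that V_eq[OF ss] by auto
    then show ?thesis unfolding pT' using ss \<xi> by (auto simp: inner_pt algebra_simps)
  qed
  have vel: "?v - (3/2 * (?v \<bullet> ?z)) *\<^sub>R (?w + ?z) = pt (-2 * ?a * s) (2 * ?b * s') (2 * (?a + ?b) * (s * s'))"
    unfolding pt_simps pt_inject using ss by (elim disjE; simp; simp add: field_simps)
  note nl = next_leg_eq[of ?w ?z "T' - T" ?v "path T" T, unfolded q, OF wz u, folded leg]
  show ?thesis
  proof (rule that[OF less cell' new])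
    show "end_time V (leg_of T i j (i + j + 1)) = T'" using nl(1) by simp
    have "next_leg V (leg_of T i j (i + j + 1)) = \<lparr>omitted = ?z, start_time = T', start_point = path T', velocity = pt (-2 * ?a * s) (2 * ?b * s') (2 * (?a + ?b) * (s * s'))\<rparr>"
      using nl(2) unfolding vel leg by simp
    also have "\<dots> = leg_of T' i (j + 1) (i + j + 1)"
      unfolding leg_of_def sg_simps sg_add s_def[symmetric] s'_def[symmetric]
      using ss by (auto simp: algebra_simps)
    finally show "next_leg V (leg_of T i j (i + j + 1)) = leg_of T' i (j + 1) (i + j + 1)" .
  qed
qed

text \<open>A tie between the two exits of a downward triangle would be a lattice point, that is a
  vertex, reached at a positive time; \<open>irrational\<close> excludes it. The sum of the integer
  parts counts the crossings.\<close>

lemma next_crossing: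
  assumes T: "strictly_in_cell T i j k" "T \<ge> 0"
  obtains T' i' j' k' where "T < T'" "in_cell T' i j k" "strictly_in_cell T' i' j' k'" "i' + j' + k' = i + j + k + 1"
    "end_time V (leg_of T i j k) = T'" "next_leg V (leg_of T i j k) = leg_of T' i' j' k'"
proof -
  have T1: "i \<le> T * \<alpha> $ 1" "T * \<alpha> $ 1 < i + 1" "j \<le> T * \<alpha> $ 2" "T * \<alpha> $ 2 < j + 1"
    "k \<le> T * \<alpha> $ 1 + T * \<alpha> $ 2" "T * \<alpha> $ 1 + T * \<alpha> $ 2 < k + 1"
    using T unfolding strictly_in_cell_def in_cell_def by (auto simp: distrib_left)
  then consider "k = i + j" | "k = i + j + 1" by linarith
  then show ?thesis
  proof cases
    case 1
    with T have "strictly_in_cell T i j (i + j)" by simp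
    from crossing_up[OF this] obtain T' where "T < T'" "in_cell T' i j (i + j)" "strictly_in_cell T' i j (i + j + 1)"
      "end_time V (leg_of T i j (i + j)) = T'" "next_leg V (leg_of T i j (i + j)) = leg_of T' i j (i + j + 1)" .
    then show ?thesis using 1 by (intro that[of T' i j "i + j + 1"]) simp_all
  next
    case 2
    with T have cell: "strictly_in_cell T i j (i + j + 1)" by simp
    consider "(real_of_int i + 1) / \<alpha> $ 1 < (real_of_int j + 1) / \<alpha> $ 2"
      | "(real_of_int j + 1) / \<alpha> $ 2 < (real_of_int i + 1) / \<alpha> $ 1"
      | "(real_of_int i + 1) / \<alpha> $ 1 = (real_of_int j + 1) / \<alpha> $ 2" by linarith
    then show ?thesis
    proof cases
      case 1
      from crossing_down_1[OF cell 1] obtain T' where "T < T'" "in_cell T' i j (i + j + 1)" "strictly_in_cell T' (i + 1) j (i + j + 1)"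
        "end_time V (leg_of T i j (i + j + 1)) = T'"
        "next_leg V (leg_of T i j (i + j + 1)) = leg_of T' (i + 1) j (i + j + 1)" .
      then show ?thesis using 2 by (intro that[of T' "i + 1" j "i + j + 1"]) simp_all
    next
      case 2
      from crossing_down_2[OF cell 2] obtain T' where "T < T'" "in_cell T' i j (i + j + 1)" "strictly_in_cell T' i (j + 1) (i + j + 1)"
        "end_time V (leg_of T i j (i + j + 1)) = T'"
        "next_leg V (leg_of T i j (i + j + 1)) = leg_of T' i (j + 1) (i + j + 1)" .
      then show ?thesis using \<open>k = i + j + 1\<close> by (intro that[of T' i "j + 1" "i + j + 1"]) simp_all
    next
      case 3
      define t where "t = (real_of_int i + 1) / \<alpha> $ 1"
      have "t * \<alpha> $ 1 = of_int (i + 1)" using pos by (simp add: t_def)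
      moreover have "t * \<alpha> $ 2 = of_int (j + 1)" using pos 3 by (simp add: t_def)
      moreover have "0 < t"
      proof -
        have "0 \<le> T * \<alpha> $ 1" using T(2) pos by simp
        then have "0 < real_of_int (i + 1)" using T1(2) by simp
        then show ?thesis using pos by (simp add: t_def)
      qed
      ultimately show ?thesis using irrational[of t] by (metis Ints_of_int)
    qed
  qed
qed

text \<open>The condition \<open>i + j + k = int n\<close> forces
  \<open>n \<le> 2 * T * (\<alpha> $ 1 + \<alpha> $ 2)\<close>, so crossing times cannot
  accumulate.\<close>

definition flow_state :: "nat \<Rightarrow> real \<Rightarrow> int \<Rightarrow> int \<Rightarrow> int \<Rightarrow> bool" where
  "flow_state n T i j k \<longleftrightarrow> flow_leg A B C D \<alpha> n = leg_of T i j k \<and> strictly_in_cell T i j k \<and> 0 \<le> T \<and>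
     i + j + k = int n"

lemma flow_state_exists: "\<exists>T i j k. flow_state n T i j k"
proof (induction n)
  case 0
  have "flow_state 0 0 0 0 0"
    using pos by (simp add: flow_state_def flow_leg_def leg_of_def strictly_in_cell_def in_cell_def dev_def
        tri_of_int[of 0, simplified] pt_simps pt_inject)
  then show ?case by blast
next
  case (Suc n)
  then obtain T i j k where s: "flow_leg A B C D \<alpha> n = leg_of T i j k" "strictly_in_cell T i j k" "0 \<le> T" "i + j + k = int n"
    unfolding flow_state_def by blast
  obtain T' i' j' k' where s': "T < T'" "strictly_in_cell T' i' j' k'" "i' + j' + k' = i + j + k + 1"
    "next_leg V (leg_of T i j k) = leg_of T' i' j' k'"
    using next_crossing[OF s(2,3)] by metis
  have "flow_leg A B C D \<alpha> (Suc n) = leg_of T' i' j' k'"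
    using s(1) s'(4) by (simp add: flow_leg_def)
  then have "flow_state (Suc n) T' i' j' k'"
    using s s' by (simp add: flow_state_def)
  then show ?case by blast
qed

lemma flow_start: "start_time (flow_leg A B C D \<alpha> 0) = 0"
  "start_time (flow_leg A B C D \<alpha> (Suc n)) = end_time V (flow_leg A B C D \<alpha> n)"
  by (simp_all add: flow_leg_def next_leg_def Let_def)

text \<open>Crossing times are unbounded, so the least \<open>n\<close> exists and its leg contains
  the time \<open>t\<close>; on one leg the folded ray is affine with the velocity of the
  leg.\<close>

lemma tetra_flow_eq:
  assumes "t \<ge> 0"
  shows "tetra_flow A B C D \<alpha> t = path t"
proof -
  let ?l = "flow_leg A B C D \<alpha>" and ?a = "\<alpha> $ 1" and ?b = "\<alpha> $ 2"
  let ?P = "\<lambda>n. t \<le> end_time V (?l n)"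
  have "\<exists>n. ?P n"
  proof -
    obtain n :: nat where n: "2 * t * (?a + ?b) \<le> n" using real_arch_simple by blast
    obtain T i j k where s: "?l n = leg_of T i j k" "strictly_in_cell T i j k" "0 \<le> T" "i + j + k = int n"
      using flow_state_exists[of n] unfolding flow_state_def by blast
    obtain T' where T': "T < T'" "end_time V (leg_of T i j k) = T'"
      using next_crossing[OF s(2,3)] by metis
    have "real_of_int (i + j + k) = n" using s(4) by simp
    then have "n \<le> 2 * T * (?a + ?b)"
      using s(2) unfolding strictly_in_cell_def in_cell_def by (simp add: distrib_left)
    then have "t * (?a + ?b) \<le> T * (?a + ?b)" using n by simp
    then have "t \<le> T" using pos by simp
    then show ?thesis using T' s(1) by (intro exI[of _ n]) simp
  qed
  then have Least: "?P (LEAST n. ?P n)" by (rule LeastI_ex)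
  define n where "n = (LEAST n. ?P n)"
  have upper: "t \<le> end_time V (?l n)" using Least by (simp add: n_def)
  have start: "start_time (?l n) \<le> t"
  proof (cases n)
    case 0
    then show ?thesis using assms by (simp add: flow_start)
  next
    case (Suc m)
    then have "\<not> ?P m" using not_less_Least[of m ?P] by (simp add: n_def)
    then show ?thesis using Suc by (simp add: flow_start)
  qed
  obtain T i j k where s: "?l n = leg_of T i j k" "strictly_in_cell T i j k" "0 \<le> T" "i + j + k = int n"
    using flow_state_exists[of n] unfolding flow_state_def by blast
  obtain T' where T': "T < T'" "in_cell T' i j k" "end_time V (leg_of T i j k) = T'"
    using next_crossing[OF s(2,3)] by metis
  have cell: "in_cell T i j k" using s(2) by (simp add: strictly_in_cell_def)
  have "in_cell t i j k"
  proof (rule in_cell_mono[OF cell T'(2)])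
    show "T \<le> t" using start s(1) by (simp add: leg_of_def)
    show "t \<le> T'" using T'(3) upper s(1) by simp
  qed
  from path_along_leg[OF cell this] show ?thesis
    unfolding tetra_flow_def Let_def n_def[symmetric] s(1) by (simp add: leg_of_def)
qed

end

subsection \<open>Density of the flow on the sphere\<close>

lemma radial_lipschitz:
  assumes "v \<noteq> 0"
  shows "norm (radial v - radial w) \<le> 2 * norm (v - w) / norm v"
proof (cases "w = 0")
  \<comment> \<open>Here \<open>radial 0 = 0\<close> because \<open>inverse 0 = 0\<close>, and the
    bound reads \<open>1 \<le> 2\<close>.\<close>
  case True
  then show ?thesis using assms by (simp add: radial_def)
next
  case False
  have "radial v - radial w = (1 / norm v) *\<^sub>R (v - w) + ((norm w - norm v) / (norm v * norm w)) *\<^sub>R w"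
    using assms False by (simp add: radial_def diff_divide_distrib divide_inverse algebra_simps)
  also have "norm \<dots> \<le> norm (v - w) / norm v + \<bar>norm w - norm v\<bar> / norm v"
    using False by (intro order_trans[OF norm_triangle_ineq]) (simp add: abs_divide)
  also have "\<dots> \<le> norm (v - w) / norm v + norm (v - w) / norm v"
    using norm_triangle_ineq3[of w v] by (intro add_left_mono divide_right_mono) (auto simp: norm_minus_commute)
  finally show ?thesis by simp
qed

context tetrahedron
begin

lemma pt_0: "pt 0 0 0 = 0"
  by (simp add: pt_def)

lemma norm_pt_le: "norm (pt a b c) \<le> \<bar>a\<bar> + \<bar>b\<bar> + \<bar>c\<bar>"
proof -
  have E: "norm E1 \<le> 1" "norm E2 \<le> 1" "norm E3 \<le> 1"
    using inner_axes by (simp_all add: norm_eq_sqrt_inner)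
  have "norm (pt a b c) \<le> norm (a *\<^sub>R E1) + norm (b *\<^sub>R E2) + norm (c *\<^sub>R E3)"
    unfolding pt_def by (meson add_right_mono norm_triangle_ineq order_trans)
  also have "\<dots> \<le> \<bar>a\<bar> * 1 + \<bar>b\<bar> * 1 + \<bar>c\<bar> * 1"
    unfolding norm_scaleR by (intro add_mono mult_left_mono E) auto
  finally show ?thesis by simp
qed

lemma dev_lipschitz:
  assumes "\<bar>x - x'\<bar> \<le> \<delta>" "\<bar>y - y'\<bar> \<le> \<delta>"
  shows "norm (dev x y - dev x' y') \<le> 8 * \<delta>"
proof -
  have "norm (dev x y - dev x' y') \<le> \<bar>tri x - tri x'\<bar> + \<bar>tri y - tri y'\<bar> + \<bar>tri (x + y) - tri (x' + y')\<bar>"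
    unfolding dev_def pt_diff by (rule norm_pt_le)
  moreover have "\<bar>x + y - (x' + y')\<bar> \<le> 2 * \<delta>" using assms by linarith
  ultimately show ?thesis
    using assms tri_lipschitz[of x x'] tri_lipschitz[of y y'] tri_lipschitz[of "x + y" "x' + y'"] by linarith
qed

text \<open>Lattice translations fold to the sign changes with product 1, the half-turns of the
  tetrahedron together with the identity. Even translations fold to the identity.\<close>

lemma dev_add_int:
  "dev (x + of_int m) (y + of_int m') = pt (sg m * tri x) (sg m' * tri y) (sg m * sg m' * tri (x + y))"
proof -
  have "x + of_int m + (y + of_int m') = x + y + of_int (m + m')" by simp
  then show ?thesis unfolding dev_def by (simp only: tri_add_int sg_add)
qed

lemma dev_periodic: "dev (x + 2 * of_int m) (y + 2 * of_int m') = dev x y"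
  using dev_add_int[of x "2 * m" y "2 * m'"] by (simp add: dev_def)

text \<open>The surface misses the centroid: zeros of the wave are half-integers, but the sum of two
  of them is an integer, where the wave is 1 or -1.\<close>

lemma dev_nonzero: "dev x y \<noteq> 0"
proof
  assume "dev x y = 0"
  then have 0: "tri x = 0" "tri y = 0" "tri (x + y) = 0"
    unfolding dev_def by (metis pt_0 pt_inject)+
  have half: "t = of_int \<lfloor>t\<rfloor> + 1/2" if "tri t = 0" for t
    using that sg_cases[of "\<lfloor>t\<rfloor>"] unfolding tri_def by auto
  have "x + y = of_int (\<lfloor>x\<rfloor> + \<lfloor>y\<rfloor> + 1)" using half[OF 0(1)] half[OF 0(2)] by simp
  then have "tri (x + y) = sg (\<lfloor>x\<rfloor> + \<lfloor>y\<rfloor> + 1)" by (metis tri_of_int)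
  then show False using 0(3) sg_cases[of "\<lfloor>x\<rfloor> + \<lfloor>y\<rfloor> + 1"] by simp
qed

text \<open>A half-turn carries the face to \<open>ABC\<close>, the image of the triangle
  \<open>0 \<le> x\<close>, \<open>0 \<le> y\<close>, \<open>x + y \<le> 1\<close>. There
  \<open>dev\<close> is affine, with inverse \<open>x = (1 - a) / 2\<close>,
  \<open>y = (1 - b) / 2\<close>.\<close>

lemma dev_onto_face:
  assumes "m \<in> {0, 1}" "m' \<in> {0, 1}"
    and "sg m * p + sg m' * q - sg m * sg m' * r = 1"
    and "p + q - r \<le> 1" "- p - q - r \<le> 1" "p - q + r \<le> 1" "- p + q + r \<le> 1"
  obtains x y where "dev x y = pt p q r"
proof -
  define a b c where "a = sg m * p" and "b = sg m' * q" and "c = sg m * sg m' * r"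
  have "a + b - c = 1" using assms(3) by (simp add: a_def b_def c_def)
  moreover have "- a - b - c \<le> 1" "a - b + c \<le> 1" "- a + b + c \<le> 1"
    using assms(1,2,4-7) by (auto simp: a_def b_def c_def)
  ultimately have abc: "a \<le> 1" "b \<le> 1" "0 \<le> a + b" "c = a + b - 1" by linarith+
  have "tri ((1 - a) / 2) = a" "tri ((1 - b) / 2) = b" "tri ((1 - a) / 2 + (1 - b) / 2) = c"
    using abc tri_eq[of 0 "(1 - a) / 2"] tri_eq[of 0 "(1 - b) / 2"] tri_eq[of 0 "(1 - a) / 2 + (1 - b) / 2"]
    by (simp_all add: field_simps)
  then have "dev ((1 - a) / 2 + of_int m) ((1 - b) / 2 + of_int m') = pt (sg m * a) (sg m' * b) (sg m * sg m' * c)"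
    by (simp only: dev_add_int)
  also have "\<dots> = pt p q r" using assms(1,2) by (auto simp: a_def b_def c_def)
  finally show ?thesis by (rule that)
qed

text \<open>\<open>M\<close> is the gauge of the tetrahedron at \<open>w\<close>: each
  \<open>f m m'\<close> is \<open>-3 * (u \<bullet> w)\<close> for a vertex \<open>u\<close>. The
  four values sum to 0 and do not all vanish, so \<open>M > 0\<close>, and \<open>w\<close> divided
  by \<open>M\<close> lies on a face. The bound 1/3 is the inradius.\<close>

lemma dev_onto_directions:
  assumes "w \<noteq> 0"
  obtains x y t where "t > 0" "dev x y = t *\<^sub>R w" "norm (dev x y) \<ge> 1/3"
proof -
  obtain p q r where w: "w = pt p q r" by (rule pt_surj)
  define f where "f = (\<lambda>m m'. sg m * p + sg m' * q - sg m * sg m' * r)"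
  have f: "f 0 0 = p + q - r" "f 1 1 = - p - q - r" "f 0 1 = p - q + r" "f 1 0 = - p + q + r"
    by (simp_all add: f_def)
  define M where "M = Max {f 0 0, f 1 1, f 0 1, f 1 0}"
  have le: "f 0 0 \<le> M" "f 1 1 \<le> M" "f 0 1 \<le> M" "f 1 0 \<le> M"
    unfolding M_def by (intro Max_ge; simp)+
  have "M \<in> {f 0 0, f 1 1, f 0 1, f 1 0}" unfolding M_def by (rule Max_in) auto
  then obtain m m' :: int where m: "m \<in> {0, 1}" "m' \<in> {0, 1}" "f m m' = M" by blast
  have M: "M > 0"
  proof (rule ccontr)
    assume "\<not> ?thesis"
    then have "p + q - r = 0" "- p - q - r = 0" "p - q + r = 0" "- p + q + r = 0"
      using le unfolding f by linarith+
    then have "p = 0" "q = 0" "r = 0" by linarith+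
    then show False using assms by (simp add: w pt_0)
  qed
  obtain x y where xy: "dev x y = pt (p / M) (q / M) (r / M)"
  proof (rule dev_onto_face[OF m(1,2)])
    show "sg m * (p / M) + sg m' * (q / M) - sg m * sg m' * (r / M) = 1"
      using m(3) M unfolding f_def by (simp add: field_simps)
    show "p / M + q / M - r / M \<le> 1" "- (p / M) - q / M - r / M \<le> 1"
      "p / M - q / M + r / M \<le> 1" "- (p / M) + q / M + r / M \<le> 1"
    proof -
      have "(p + q - r) / M \<le> 1" "(- p - q - r) / M \<le> 1" "(p - q + r) / M \<le> 1" "(- p + q + r) / M \<le> 1"
        using le M unfolding f by simp_all
      then show "p / M + q / M - r / M \<le> 1" "- (p / M) - q / M - r / M \<le> 1"
        "p / M - q / M + r / M \<le> 1" "- (p / M) + q / M + r / M \<le> 1"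
        by (simp_all add: add_divide_distrib diff_divide_distrib)
    qed
  qed
  have "M\<^sup>2 \<le> 3 * (p\<^sup>2 + q\<^sup>2 + r\<^sup>2)"
  proof -
    define a b c where "a = sg m * p" and "b = sg m' * q" and "c = sg m * sg m' * r"
    \<comment> \<open>Cauchy-Schwarz; the difference of the two sides is the sum of the three
      squares supplied.\<close>
    have "(a + b - c)\<^sup>2 \<le> 3 * (a\<^sup>2 + b\<^sup>2 + c\<^sup>2)"
      using zero_le_power2[of "a - b"] zero_le_power2[of "a + c"] zero_le_power2[of "b + c"]
      by (simp add: power2_eq_square algebra_simps)
    moreover have "a\<^sup>2 = p\<^sup>2" "b\<^sup>2 = q\<^sup>2" "c\<^sup>2 = r\<^sup>2"
      using m(1,2) by (auto simp: a_def b_def c_def)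
    moreover have "M = a + b - c" using m(3) by (simp add: f_def a_def b_def c_def)
    ultimately show ?thesis by simp
  qed
  also have "\<dots> = 9 * M\<^sup>2 * (norm (dev x y))\<^sup>2"
    using M unfolding xy power2_norm_eq_inner inner_pt by (simp add: field_simps power2_eq_square)
  finally have "M\<^sup>2 * 1 \<le> M\<^sup>2 * (3 * norm (dev x y))\<^sup>2" by (simp add: power_mult_distrib)
  then have "1\<^sup>2 \<le> (3 * norm (dev x y))\<^sup>2" using M by (subst (asm) mult_le_cancel_left_pos) auto
  then have "1 \<le> 3 * norm (dev x y)" by (rule power2_le_imp_le) simp
  then show ?thesis using xy M by (intro that[of "1 / M" x y]) (simp_all add: w pt_scaleR)
qed

end

text \<open>Closeness modulo the period \<open>2\<int>\<^sup>2\<close> is closeness of half the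
  coordinates modulo \<open>\<int>\<^sup>2\<close>. Even numerators in the bound for \<alpha> make
  \<open>\<alpha> / 2\<close> badly approximable with constant \<open>c / 2\<close>.\<close>

lemma (in tetrahedron_flow) tetra_flow_covering:
  assumes "badly_approximable \<alpha>"
  obtains K where "covering_sequence (\<lambda>p. radial (tetra_flow A B C D \<alpha> (real p))) K"
proof -
  obtain c where "bad_pair (\<alpha> $ 1) (\<alpha> $ 2) c"
    using bad_pair_if_badly_approximable[OF assms] by blast
  note c = bad_pair.c_pos[OF this] bad_pair.bad[OF this]
  interpret bad_pair "\<alpha> $ 1 / 2" "\<alpha> $ 2 / 2" "c / 2"
  proof
    show "c / 2 > 0" using c by simp
    fix q :: nat and m\<^sub>1 m\<^sub>2 :: int assume q: "1 \<le> q"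
    have "\<bar>q * \<alpha> $ i - of_int (2 * m)\<bar> = 2 * \<bar>q * (\<alpha> $ i / 2) - of_int m\<bar>" for i and m :: int
      by (simp add: abs_if field_simps)
    then show "c / 2 \<le> sqrt q * (\<bar>q * (\<alpha> $ 1 / 2) - m\<^sub>1\<bar> + \<bar>q * (\<alpha> $ 2 / 2) - m\<^sub>2\<bar>)"
      using c(2)[OF q, of "2 * m\<^sub>1" "2 * m\<^sub>2"] by (simp only: flip: distrib_left)
  qed
  obtain K where K: "K > 0" and near: "\<forall>a\<ge>1. \<forall>M::nat. \<forall>z\<^sub>1 z\<^sub>2. \<exists>p m\<^sub>1 m\<^sub>2. M < p \<and> real p \<le> M + K * (real a)\<^sup>2 \<and>
     \<bar>real p * (\<alpha> $ 1 / 2) - of_int m\<^sub>1 - z\<^sub>1\<bar> \<le> K / a \<and> \<bar>real p * (\<alpha> $ 2 / 2) - of_int m\<^sub>2 - z\<^sub>2\<bar> \<le> K / a"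
    using multiples_covering by (elim exE conjE)
  \<comment> \<open>96 = 2 * 8 * 2 * 3: the factor in \<open>radial_lipschitz\<close>, the one in
    \<open>dev_lipschitz\<close>, undoing the halving, and the inverse of the inradius.\<close>
  have "covering_sequence (\<lambda>p. radial (tetra_flow A B C D \<alpha> (real p))) (96 * K)"
  proof
    show "norm (radial (tetra_flow A B C D \<alpha> (real p))) = 1" for p
      by (simp add: tetra_flow_eq radial_def dev_nonzero)
    show "96 * K > 0" using K by simp
    fix a M :: nat and w :: "real^3" assume a: "1 \<le> a" and w: "norm w = 1"
    then have "w \<noteq> 0" by auto
    then obtain x y t where xy: "t > 0" "dev x y = t *\<^sub>R w" "norm (dev x y) \<ge> 1/3"
      by (rule dev_onto_directions)
    obtain p m\<^sub>1 m\<^sub>2 where p: "M < p" "real p \<le> M + K * (real a)\<^sup>2"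
      "\<bar>real p * (\<alpha> $ 1 / 2) - of_int m\<^sub>1 - x / 2\<bar> \<le> K / a" "\<bar>real p * (\<alpha> $ 2 / 2) - of_int m\<^sub>2 - y / 2\<bar> \<le> K / a"
      using near[rule_format, OF a, of M "x / 2" "y / 2"] by (elim exE conjE)
    let ?f = "path (real p)"
    have "norm (dev x y - ?f) \<le> 8 * (2 * (K / a))"
    proof -
      have "?f = dev (real p * \<alpha> $ 1 + 2 * of_int (- m\<^sub>1)) (real p * \<alpha> $ 2 + 2 * of_int (- m\<^sub>2))"
        by (rule dev_periodic[symmetric])
      also have "norm (dev x y - \<dots>) \<le> 8 * (2 * (K / a))"
        using p(3,4) by (intro dev_lipschitz) (simp_all add: abs_le_iff)
      finally show ?thesis .
    qed
    moreover have "dev x y \<noteq> 0" by (rule dev_nonzero)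
    moreover have "radial (dev x y) = w" using xy w by (simp add: radial_def)
    ultimately have "norm (w - radial ?f) \<le> 2 * (8 * (2 * (K / a))) / norm (dev x y)"
      using radial_lipschitz[of "dev x y" ?f] by (smt (verit) divide_right_mono norm_ge_zero)
    also have "\<dots> \<le> 2 * (8 * (2 * (K / a))) / (1/3)"
      using xy(3) K by (intro divide_left_mono) auto
    finally have "norm (radial ?f - w) \<le> 96 * K / a" by (simp add: norm_minus_commute)
    moreover have "real p \<le> M + 96 * K * (real a)\<^sup>2"
    proof -
      have "0 \<le> K * (real a)\<^sup>2" using K by simp
      then show ?thesis using p(2) by linarith
    qed
    ultimately show "\<exists>p>M. real p \<le> M + 96 * K * (real a)\<^sup>2 \<and> norm (radial (tetra_flow A B C D \<alpha> (real p)) - w) \<le> 96 * K / a"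
      using p(1) by (intro exI[of _ p]) (simp add: tetra_flow_eq)
  qed
  then show ?thesis by (rule that)
qed

theorem theorem5p1:
  fixes A B C D :: "real^3" and \<alpha> :: "real^2"
  assumes "regular_tetrahedron A B C D"
    and "(1/4) *\<^sub>R (A + B + C + D) = 0"
    and "norm A = 1" and "norm B = 1" and "norm C = 1" and "norm D = 1"
    and "badly_approximable \<alpha>"
    and "\<alpha> $ 1 > 0" and "\<alpha> $ 2 > 0"
  shows "\<exists>\<gamma>\<^sub>0>0. \<forall>\<gamma>. 0 < \<gamma> \<and> \<gamma> < \<gamma>\<^sub>0 \<longrightarrow>
    (let x = (\<lambda>p::nat. radial (tetra_flow A B C D \<alpha> (real p)));
         j = greedy_index x \<gamma>;
         u = (\<lambda>k. x (j k))
     in (\<forall>k\<ge>2. \<exists>p. p > j (k - 1) \<and> x p \<notin> excluded_region \<gamma> k u) \<and>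
        delone {root 3 (real k) *\<^sub>R u k |k. 1 \<le> k})"
proof -
  have sum: "A + B + C + D = 0" using assms(2) by simp
  obtain l where l: "dist A B = l" "dist A C = l" "dist A D = l" "dist B C = l" "dist B D = l" "dist C D = l"
    using assms(1) unfolding regular_tetrahedron_def by blast
  have unit: "A \<bullet> A = 1" "B \<bullet> B = 1" "C \<bullet> C = 1" "D \<bullet> D = 1"
    using assms(3-6) by (simp_all add: norm_eq_1)
  have "X \<bullet> Y = 1 - l\<^sup>2 / 2" if "X \<bullet> X = 1" "Y \<bullet> Y = 1" "dist X Y = l" for X Y :: "real^3"
  proof -
    have "l\<^sup>2 = (X - Y) \<bullet> (X - Y)" using that(3) unfolding dist_norm by (metis power2_norm_eq_inner)
    then show ?thesis using that(1,2) by (simp add: inner_simps inner_commute[of Y X] field_simps)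
  qed
  note inner_l = this[OF unit(1,2) l(1)] this[OF unit(1,3) l(2)] this[OF unit(1,4) l(3)]
    this[OF unit(2,3) l(4)] this[OF unit(2,4) l(5)] this[OF unit(3,4) l(6)]
  have "A \<bullet> (A + B + C + D) = 0" by (simp add: sum)
  \<comment> \<open>Expanding \<open>A \<bullet> (A + B + C + D) = 0\<close> gives 1 plus three
    times the common inner product of two vertices.\<close>
  then have "1 - l\<^sup>2 / 2 = - 1 / 3" by (simp add: inner_add_right unit inner_l)
  note inner = inner_l[unfolded this]
  note comm = inner_commute[of B A] inner_commute[of C A] inner_commute[of D A]
    inner_commute[of C B] inner_commute[of D B] inner_commute[of D C]
  \<comment> \<open>Midpoints of the three edges at \<open>B\<close>: with inner products -1/3 they
    are pairwise orthogonal, of squared length \<open>(2 - 2/3) / 4 = 1/3\<close>.\<close>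
  interpret T: tetrahedron "(1/2) *\<^sub>R (A + B)" "(1/2) *\<^sub>R (B + C)" "(1/2) *\<^sub>R (B + D)"
    by unfold_locales (simp_all only: inner_scaleR_left inner_scaleR_right inner_add_left inner_add_right
        comm unit inner, simp_all)
  interpret T: tetrahedron_flow "(1/2) *\<^sub>R (A + B)" "(1/2) *\<^sub>R (B + C)" "(1/2) *\<^sub>R (B + D)" \<alpha>
    using assms(8,9) badly_approximable_irrational[OF assms(7)] by unfold_locales blast+
  have vertices: "T.A = A" "T.B = B" "T.C = C" "T.D = D"
  proof -
    have "T.A = A - (1/2) *\<^sub>R (A + B + C + D)" "T.B = B + (1/2) *\<^sub>R (A + B + C + D)"
      "T.C = C - (1/2) *\<^sub>R (A + B + C + D)" "T.D = D - (1/2) *\<^sub>R (A + B + C + D)"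
      unfolding T.pt_def by (simp_all add: vec_eq_iff field_simps)
    then show "T.A = A" "T.B = B" "T.C = C" "T.D = D" unfolding sum by simp_all
  qed
  define x where "x = (\<lambda>p::nat. radial (tetra_flow A B C D \<alpha> (real p)))"
  obtain K where K: "covering_sequence x K"
    using T.tetra_flow_covering[OF assms(7)] unfolding vertices x_def by blast
  have "(\<forall>k\<ge>2. \<exists>p. p > greedy_index x \<gamma> (k - 1) \<and> x p \<notin> excluded_region \<gamma> k (\<lambda>k. x (greedy_index x \<gamma> k))) \<and>
      delone {root 3 (real k) *\<^sub>R x (greedy_index x \<gamma> k) |k. 1 \<le> k}"
    if "0 < \<gamma>" "\<gamma> < 1/16" for \<gamma>
  proof -
    interpret covering_sequence x K by (rule K)
    interpret greedy x K \<gamma> using that by unfold_locales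
    show ?thesis using j_step(1,2) delone_spiral by blast
  qed
  then show ?thesis unfolding Let_def x_def[symmetric] by (intro exI[of _ "1/16"]) auto
qed

end
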